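(* For all integers $a,b\geq 0$ the polynomial $h^\ast_{a,b}(t)$ has only real roots, and for all integers $a\geq 0$, $b\geq 1$, \[ h^\ast_{a,b-1}(t)\preceq h^\ast_{a,b}(t), \] i.e. $h^\ast_{a,b-1}$ interlaces $h^\ast_{a,b}$.
   Context: For a finite simple graph $G=(V,E)$ the symmetric edge polytope is $P_G=\mathrm{conv}(e_v-e_w,\,e_w-e_v : vw\in E)\subset\mathbb{R}^V$. For integers $a,b\ge 0$, $P=P_{K_{a+1,b+1}}$ (complete bipartite graph with parts of sizes $a+1$, $b+1$) has dimension $d=a+b+1$, and $h^\ast_{a,b}(t)$ is defined by $\sum_{n\geq 0}|nP\cap\mathbb{Z}^V|t^n=h^\ast_{a,b}(t)/(1-t)^{d+1}$. For real-rooted polynomials $f,g$ with roots $a_1\geq a_2\geq\cdots$ of $f$ and $b_1\geq b_2\geq\cdots$ of $g$ (with multiplicity), we write $g\preceq f$ ($g$ interlaces $f$) if $a_1\geq b_1\geq a_2\geq b_2\geq\cdots$. *)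

theory Defs
  imports "HOL-Analysis.Analysis" "HOL-Analysis.Finite_Function_Topology"
    "HOL-Computational_Algebra.Polynomial_FPS"
begin

definition finite_simple_graph :: "'v set \<Rightarrow> 'v set set \<Rightarrow> bool" where
  "finite_simple_graph V E \<longleftrightarrow> finite V \<and> (\<forall>e\<in>E. e \<subseteq> V \<and> card e = 2)"

text \<open>
  The space of real vectors indexed by a finite vertex set \<open>V\<close> is the subspace
  of vectors supported on \<open>V\<close> in the library's real vector space
  \<open>'v \<Rightarrow>\<^sub>0 real\<close> of finitely supported functions. This keeps the size of \<open>V\<close> a term
  rather than a type. The basis vector of \<open>v\<close> is \<open>Poly_Mapping.single v 1\<close>.
\<close>

text \<open>Since \<open>{v, w} = {w, v}\<close>, every edge contributes both signs.\<close>

definition symmetric_edge_polytope :: "'v set set \<Rightarrow> ('v \<Rightarrow>\<^sub>0 real) set" where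
  "symmetric_edge_polytope E =
     convex hull {Poly_Mapping.single v 1 - Poly_Mapping.single w 1 | v w. {v, w} \<in> E}"

definition integer_lattice :: "'v set \<Rightarrow> ('v \<Rightarrow>\<^sub>0 real) set" where
  "integer_lattice V =
     {x. Poly_Mapping.keys x \<subseteq> V \<and> (\<forall>v\<in>V. Poly_Mapping.lookup x v \<in> \<int>)}"

definition ehrhart_series :: "'v set \<Rightarrow> ('v \<Rightarrow>\<^sub>0 real) set \<Rightarrow> real fps" where
  "ehrhart_series V P =
     Abs_fps (\<lambda>n. real (card (((*\<^sub>R) (real n) ` P) \<inter> integer_lattice V)))"

text \<open>The parameter \<open>d\<close> is the dimension of \<open>P\<close>.\<close>

definition h_star :: "'v set \<Rightarrow> ('v \<Rightarrow>\<^sub>0 real) set \<Rightarrow> nat \<Rightarrow> real poly" where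
  "h_star V P d =
     (THE h. ehrhart_series V P = fps_of_poly h / (1 - fps_X) ^ (d + 1))"

definition bipartite_vertices :: "nat \<Rightarrow> nat \<Rightarrow> (nat + nat) set" where
  "bipartite_vertices m n = {..<m} <+> {..<n}"

definition bipartite_edges :: "nat \<Rightarrow> nat \<Rightarrow> (nat + nat) set set" where
  "bipartite_edges m n = {{Inl i, Inr j} | i j. i < m \<and> j < n}"

lemma finite_simple_graph_bipartite:
  "finite_simple_graph (bipartite_vertices m n) (bipartite_edges m n)"
  unfolding finite_simple_graph_def bipartite_vertices_def bipartite_edges_def
  by auto

text \<open>The symmetric edge polytope of \<open>K\<^bsub>a+1,b+1\<^esub>\<close> has dimension \<open>a + b + 1\<close>.\<close>

definition h_star_bipartite :: "nat \<Rightarrow> nat \<Rightarrow> real poly" where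
  "h_star_bipartite a b =
     h_star (bipartite_vertices (a + 1) (b + 1))
       (symmetric_edge_polytope (bipartite_edges (a + 1) (b + 1))) (a + b + 1)"

text \<open>The zero polynomial is not real-rooted in this sense.\<close>

definition real_rooted :: "real poly \<Rightarrow> bool" where
  "real_rooted p \<longleftrightarrow> (\<forall>z::complex. poly (map_poly of_real p) z = 0 \<longrightarrow> z \<in> \<real>)"

text \<open>The real roots with multiplicity, in weakly decreasing order.\<close>

definition roots_desc :: "real poly \<Rightarrow> real list" where
  "roots_desc p = rev (sorted_list_of_multiset (proots p))"

text \<open>
  \<open>interlaces g f\<close> means \<open>a\<^sub>1 \<ge> b\<^sub>1 \<ge> a\<^sub>2 \<ge> b\<^sub>2 \<ge> \<dots>\<close> for the roots \<open>a\<^sub>i\<close> of \<open>f\<close> and \<open>b\<^sub>i\<close> of \<open>g\<close>.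
  As the chain alternates and starts with \<open>a\<^sub>1\<close>, \<open>f\<close> has as many roots as \<open>g\<close> or one more.
\<close>

definition interlaces :: "real poly \<Rightarrow> real poly \<Rightarrow> bool" where
  "interlaces g f \<longleftrightarrow>
     real_rooted g \<and> real_rooted f \<and>
     (let as = roots_desc f; bs = roots_desc g in
        (length as = length bs \<or> length as = length bs + 1) \<and>
        (\<forall>i < length bs. as ! i \<ge> bs ! i) \<and>
        (\<forall>i. i + 1 < length as \<longrightarrow> bs ! i \<ge> as ! (i + 1)))"

end

theory Submission
  imports Defs "HOL-Computational_Algebra.Fundamental_Theorem_Algebra"
begin

text \<open>
  An integer point \<open>(u, -v)\<close> lies in \<open>n P\<close> iff \<open>\<Sum> u = \<Sum> v\<close> and both \<open>l\<^sup>1\<close> norms are at most \<open>n\<close>.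
  Slicing by the common sum, the Ehrhart series becomes \<open>(1 + t) \<Sum> D\<^sub>a(p,q) D\<^sub>b(p,q) t\<^bsup>p+q\<^esup>\<close>, where
  \<open>D\<^sub>a\<close> has generating function \<open>(1 - xy)\<^sup>a / ((1 - x)(1 - y))\<^bsup>a+1\<^esup>\<close>. Expanding \<open>D\<^sub>a\<close> in products of Meixner
  polynomials, which are orthogonal for the weight \<open>t\<^sup>p\<close>, gives
  \<open>h\<^sup>*(t) = (1 + t)\<^bsup>a+b+1\<^esup> \<gamma>(t / (1 + t)\<^sup>2)\<close> with \<open>\<gamma>(x) = \<Sum> (2i choose i) (a choose i) (b choose i) x\<^sup>i\<close>.

  The coefficients \<open>(2i choose i) / i!\<^sup>2\<close> belong to the square of \<open>\<Sum> x\<^sup>i / i!\<^sup>2\<close>, a limit of real-rooted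
  Laguerre polynomials. If \<open>p\<close> is a product of factors \<open>1 + s x\<close> with \<open>s > 0\<close>, then \<open>p(D) x\<^sup>n\<close> is
  real-rooted, and its reversal multiplies the coefficients of \<open>p\<close> by falling factorials of \<open>n\<close>; doing
  this for \<open>n = a\<close> and \<open>n = b\<close> shows that \<open>\<gamma>\<close> is real-rooted.

  Finally \<open>b \<gamma>\<^bsub>a,b-1\<^esub> = b \<gamma>\<^bsub>a,b\<^esub> - x \<gamma>\<^bsub>a,b\<^esub>'\<close> makes \<open>h\<^sup>*\<^bsub>a,b-1\<^esub> / h\<^sup>*\<^bsub>a,b\<^esub>\<close> a sum of simple fractions
  \<open>l / (t - r)\<close> with \<open>l \<ge> 0\<close>, which forces interlacing.
\<close>

subsection \<open>Lattice points of dilated bipartite edge polytopes\<close>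

lemma lookup_scaleR [simp]:
  fixes x :: "'a \<Rightarrow>\<^sub>0 real"
  shows "Poly_Mapping.lookup (c *\<^sub>R x) i = c * Poly_Mapping.lookup x i"
proof -
  have "finite {i. c *\<^sub>R Poly_Mapping.lookup x i \<noteq> 0}"
    by (rule finite_subset[OF _ finite_lookup[of x]]) auto
  thus ?thesis
    by (simp add: scaleR_poly_mapping_def)
qed

text \<open>The sum is n + 1 times the convex combination of \<open>p\<close> and \<open>g\<close>
  with weights n / (n + 1) and 1 / (n + 1). Points of a dilate can therefore be built by adding one
  point of \<open>P\<close> at a time.\<close>

lemma convex_scaled_add:
  assumes "convex P" "x \<in> (*\<^sub>R) (real n) ` P" "g \<in> P"
  shows "x + g \<in> (*\<^sub>R) (real (Suc n)) ` P"
proof -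
  obtain p where p: "p \<in> P" "x = real n *\<^sub>R p"
    using assms(2) by auto
  let ?y = "(real n / real (Suc n)) *\<^sub>R p + (1 / real (Suc n)) *\<^sub>R g"
  have "?y \<in> P"
    by (rule convexD[OF assms(1) p(1) assms(3)]) (auto simp: field_simps)
  moreover have "real (Suc n) *\<^sub>R ?y = x + g"
    by (simp add: p(2) scaleR_add_right del: of_nat_Suc)
  ultimately show ?thesis
    by (metis imageI)
qed

text \<open>The sign in the second part turns coordinate sum zero into \<open>\<Sum> u = \<Sum> v\<close>.\<close>

definition bip_point :: "nat \<Rightarrow> nat \<Rightarrow> (nat \<Rightarrow> int) \<Rightarrow> (nat \<Rightarrow> int) \<Rightarrow> (nat + nat) \<Rightarrow>\<^sub>0 real" where
  "bip_point m k u v =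
     (\<Sum>i<m. Poly_Mapping.single (Inl i) (of_int (u i))) - (\<Sum>j<k. Poly_Mapping.single (Inr j) (of_int (v j)))"

lemma lookup_bip_point [simp]:
  "Poly_Mapping.lookup (bip_point m k u v) (Inl i) = (if i < m then of_int (u i) else 0)"
  "Poly_Mapping.lookup (bip_point m k u v) (Inr j) = (if j < k then - of_int (v j) else 0)"
  by (simp_all add: bip_point_def lookup_minus lookup_sum lookup_single when_def)

lemma bip_point_cong:
  assumes "\<And>i. i < m \<Longrightarrow> u i = u' i" "\<And>j. j < k \<Longrightarrow> v j = v' j"
  shows "bip_point m k u v = bip_point m k u' v'"
  using assms by (simp add: bip_point_def)

lemma bip_point_lookup:
  assumes "x \<in> integer_lattice (bipartite_vertices m k)"
  shows "x = bip_point m k (\<lambda>i. \<lfloor>Poly_Mapping.lookup x (Inl i)\<rfloor>) (\<lambda>j. - \<lfloor>Poly_Mapping.lookup x (Inr j)\<rfloor>)"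
proof (rule poly_mapping_eqI)
  fix w
  have ints: "Poly_Mapping.lookup x w \<in> \<int>" if "w \<in> bipartite_vertices m k"
    using assms that by (auto simp: integer_lattice_def)
  have zero: "Poly_Mapping.lookup x w = 0" if "w \<notin> bipartite_vertices m k"
    using assms that by (auto simp: integer_lattice_def in_keys_iff)
  show "Poly_Mapping.lookup x w = Poly_Mapping.lookup
          (bip_point m k (\<lambda>i. \<lfloor>Poly_Mapping.lookup x (Inl i)\<rfloor>) (\<lambda>j. - \<lfloor>Poly_Mapping.lookup x (Inr j)\<rfloor>)) w"
    using ints[THEN of_int_floor] zero by (cases w) (auto simp: bipartite_vertices_def InlI InrI)
qed

lemma bip_point_in_lattice: "bip_point m k u v \<in> integer_lattice (bipartite_vertices m k)"
  by (auto simp: integer_lattice_def bipartite_vertices_def in_keys_iff split: if_splits)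
     (metis (no_types, lifting) InlI InrI lessThan_iff lookup_bip_point old.sum.exhaust)

abbreviation bip_polytope :: "nat \<Rightarrow> nat \<Rightarrow> ((nat + nat) \<Rightarrow>\<^sub>0 real) set" where
  "bip_polytope m k \<equiv> symmetric_edge_polytope (bipartite_edges m k)"

lemma edge_in_bip_polytope:
  assumes "i < m" "j < k"
  shows "Poly_Mapping.single (Inl i) 1 - Poly_Mapping.single (Inr j) 1 \<in> bip_polytope m k"
    and "Poly_Mapping.single (Inr j) 1 - Poly_Mapping.single (Inl i) 1 \<in> bip_polytope m k"
proof -
  have e: "{Inl i, Inr j} \<in> bipartite_edges m k" "{Inr j, Inl i} \<in> bipartite_edges m k"
    using assms by (auto simp: bipartite_edges_def)
  show "Poly_Mapping.single (Inl i) 1 - Poly_Mapping.single (Inr j) 1 \<in> bip_polytope m k"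
    unfolding symmetric_edge_polytope_def by (rule hull_inc) (use e in blast)
  show "Poly_Mapping.single (Inr j) 1 - Poly_Mapping.single (Inl i) 1 \<in> bip_polytope m k"
    unfolding symmetric_edge_polytope_def by (rule hull_inc) (use e in blast)
qed

lemma convex_bip_polytope: "convex (bip_polytope m k)"
  by (simp add: symmetric_edge_polytope_def)

lemma zero_in_bip_polytope:
  assumes "0 < m" "0 < k"
  shows "0 \<in> bip_polytope m k"
proof -
  have "(1/2) *\<^sub>R (Poly_Mapping.single (Inl 0) 1 - Poly_Mapping.single (Inr 0) 1) +
        (1/2) *\<^sub>R (Poly_Mapping.single (Inr 0) 1 - Poly_Mapping.single (Inl 0) 1) \<in> bip_polytope m k"
    by (rule convexD[OF convex_bip_polytope]) (use edge_in_bip_polytope assms in auto)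
  thus ?thesis
    by (simp add: scaleR_diff_right)
qed

text \<open>These conditions cut out a convex set that contains every generator, hence the whole
  hull. For lattice points the converse is \<open>bip_point_in_scaled\<close>.\<close>

lemma bip_polytope_bounds:
  assumes "x \<in> bip_polytope m k"
  shows "(\<Sum>i<m. Poly_Mapping.lookup x (Inl i)) + (\<Sum>j<k. Poly_Mapping.lookup x (Inr j)) = 0"
    and "(\<Sum>i<m. \<bar>Poly_Mapping.lookup x (Inl i)\<bar>) \<le> 1"
    and "(\<Sum>j<k. \<bar>Poly_Mapping.lookup x (Inr j)\<bar>) \<le> 1"
proof -
  define T :: "((nat + nat) \<Rightarrow>\<^sub>0 real) set" where "T =
    {x. (\<Sum>i<m. Poly_Mapping.lookup x (Inl i)) + (\<Sum>j<k. Poly_Mapping.lookup x (Inr j)) = 0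
      \<and> (\<Sum>i<m. \<bar>Poly_Mapping.lookup x (Inl i)\<bar>) \<le> 1
      \<and> (\<Sum>j<k. \<bar>Poly_Mapping.lookup x (Inr j)\<bar>) \<le> 1}"
  have abs_conv: "(\<Sum>i\<in>A. \<bar>c * f i + d * g i\<bar>) \<le> 1"
    if "(\<Sum>i\<in>A. \<bar>f i\<bar>) \<le> 1" "(\<Sum>i\<in>A. \<bar>g i\<bar>) \<le> 1" "0 \<le> c" "0 \<le> d" "c + d = 1"
    for A :: "nat set" and f g :: "nat \<Rightarrow> real" and c d
  proof -
    have "(\<Sum>i\<in>A. \<bar>c * f i + d * g i\<bar>) \<le> (\<Sum>i\<in>A. c * \<bar>f i\<bar> + d * \<bar>g i\<bar>)"
      by (rule sum_mono) (metis abs_mult abs_of_nonneg abs_triangle_ineq that(3,4))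
    also have "\<dots> = c * (\<Sum>i\<in>A. \<bar>f i\<bar>) + d * (\<Sum>i\<in>A. \<bar>g i\<bar>)"
      by (simp add: sum.distrib sum_distrib_left)
    also have "\<dots> \<le> c * 1 + d * 1"
      using that by (intro add_mono mult_left_mono) auto
    finally show ?thesis
      using that by simp
  qed
  have "convex T"
    unfolding convex_def
  proof (intro ballI allI impI)
    fix x y :: "(nat + nat) \<Rightarrow>\<^sub>0 real" and c d :: real
    assume H: "x \<in> T" "y \<in> T" "0 \<le> c" "0 \<le> d" "c + d = 1"
    let ?l = "\<lambda>x w. Poly_Mapping.lookup x w"
    have "(\<Sum>i<m. c * ?l x (Inl i) + d * ?l y (Inl i)) + (\<Sum>j<k. c * ?l x (Inr j) + d * ?l y (Inr j))
        = c * ((\<Sum>i<m. ?l x (Inl i)) + (\<Sum>j<k. ?l x (Inr j))) + d * ((\<Sum>i<m. ?l y (Inl i)) + (\<Sum>j<k. ?l y (Inr j)))"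
      by (simp add: sum.distrib sum_distrib_left algebra_simps)
    also have "\<dots> = 0"
      using H by (simp add: T_def)
    finally show "c *\<^sub>R x + d *\<^sub>R y \<in> T"
      using H abs_conv by (simp add: T_def lookup_add)
  qed
  moreover have "{Poly_Mapping.single v 1 - Poly_Mapping.single w 1 | v w. {v, w} \<in> bipartite_edges m k} \<subseteq> T"
    by (auto simp: T_def bipartite_edges_def doubleton_eq_iff lookup_minus lookup_single when_def
          if_distrib[of abs] sum_negf cong: if_cong)
  ultimately have "bip_polytope m k \<subseteq> T"
    unfolding symmetric_edge_polytope_def by (rule hull_minimal[rotated])
  with assms have "x \<in> T"
    by auto
  thus "(\<Sum>i<m. Poly_Mapping.lookup x (Inl i)) + (\<Sum>j<k. Poly_Mapping.lookup x (Inr j)) = 0"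
    and "(\<Sum>i<m. \<bar>Poly_Mapping.lookup x (Inl i)\<bar>) \<le> 1"
    and "(\<Sum>j<k. \<bar>Poly_Mapping.lookup x (Inr j)\<bar>) \<le> 1"
    by (auto simp: T_def)
qed

text \<open>Each term \<open>\<bar>u i\<bar> - u i\<close> is 0 or \<open>- 2 * u i\<close>. Two
  vectors with equal sums thus have l1 norms of the same parity, which rules out norms that differ
  by exactly 1.\<close>

lemma even_sum_abs_diff:
  fixes u :: "nat \<Rightarrow> int"
  shows "even ((\<Sum>i\<in>A. \<bar>u i\<bar>) - (\<Sum>i\<in>A. u i))"
  unfolding sum_subtractf[symmetric] by (rule dvd_sum) (auto simp: abs_if)

lemma sum_abs_upd:
  fixes u :: "nat \<Rightarrow> int"
  assumes "i < m"
  shows "(\<Sum>i'<m. \<bar>(u(i := c)) i'\<bar>) = (\<Sum>i'<m. \<bar>u i'\<bar>) - \<bar>u i\<bar> + \<bar>c\<bar>"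
    and "(\<Sum>i'<m. (u(i := c)) i') = (\<Sum>i'<m. u i') - u i + c"
proof -
  have "(\<Sum>i'<m. \<bar>(u(i := c)) i'\<bar>) = \<bar>c\<bar> + (\<Sum>i'\<in>{..<m}-{i}. \<bar>u i'\<bar>)"
    using assms by (subst sum.remove[of _ i]) (auto intro!: sum.cong)
  moreover have "(\<Sum>i'<m. \<bar>u i'\<bar>) = \<bar>u i\<bar> + (\<Sum>i'\<in>{..<m}-{i}. \<bar>u i'\<bar>)"
    using assms by (subst sum.remove[of _ i]) auto
  ultimately show "(\<Sum>i'<m. \<bar>(u(i := c)) i'\<bar>) = (\<Sum>i'<m. \<bar>u i'\<bar>) - \<bar>u i\<bar> + \<bar>c\<bar>"
    by simp
  have "(\<Sum>i'<m. (u(i := c)) i') = c + (\<Sum>i'\<in>{..<m}-{i}. u i')"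
    using assms by (subst sum.remove[of _ i]) (auto intro!: sum.cong)
  moreover have "(\<Sum>i'<m. u i') = u i + (\<Sum>i'\<in>{..<m}-{i}. u i')"
    using assms by (subst sum.remove[of _ i]) auto
  ultimately show "(\<Sum>i'<m. (u(i := c)) i') = (\<Sum>i'<m. u i') - u i + c"
    by simp
qed

lemma bip_point_upd:
  assumes "i < m" "j < k"
  shows "bip_point m k (u(i := u i + 1)) (v(j := v j + 1)) =
           bip_point m k u v + (Poly_Mapping.single (Inl i) 1 - Poly_Mapping.single (Inr j) 1)"
    and "bip_point m k (u(i := u i - 1)) (v(j := v j - 1)) =
           bip_point m k u v + (Poly_Mapping.single (Inr j) 1 - Poly_Mapping.single (Inl i) 1)"
proof -
  show "bip_point m k (u(i := u i + 1)) (v(j := v j + 1)) =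
           bip_point m k u v + (Poly_Mapping.single (Inl i) 1 - Poly_Mapping.single (Inr j) 1)"
  proof (rule poly_mapping_eqI)
    fix w show "Poly_Mapping.lookup (bip_point m k (u(i := u i + 1)) (v(j := v j + 1))) w =
      Poly_Mapping.lookup (bip_point m k u v + (Poly_Mapping.single (Inl i) 1 - Poly_Mapping.single (Inr j) 1)) w"
      using assms by (cases w) (auto simp: lookup_add lookup_minus lookup_single when_def)
  qed
  show "bip_point m k (u(i := u i - 1)) (v(j := v j - 1)) =
           bip_point m k u v + (Poly_Mapping.single (Inr j) 1 - Poly_Mapping.single (Inl i) 1)"
  proof (rule poly_mapping_eqI)
    fix w show "Poly_Mapping.lookup (bip_point m k (u(i := u i - 1)) (v(j := v j - 1))) w =
      Poly_Mapping.lookup (bip_point m k u v + (Poly_Mapping.single (Inr j) 1 - Poly_Mapping.single (Inl i) 1)) w"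
      using assms by (cases w) (auto simp: lookup_add lookup_minus lookup_single when_def)
  qed
qed

text \<open>Suppose \<open>u\<close> has a positive entry but \<open>v\<close> has none. Then the
  sum of \<open>v\<close> is minus its l1 norm, so by the two equalities the nonnegative terms
  \<open>u i + \<bar>u i\<bar>\<close> add up to 0, contradicting the positive entry. A negative
  entry of \<open>u\<close> is treated by negating both vectors.\<close>

lemma exists_same_sign:
  fixes u v :: "nat \<Rightarrow> int"
  assumes "(\<Sum>i<m. u i) = (\<Sum>j<k. v j)" "(\<Sum>i<m. \<bar>u i\<bar>) = (\<Sum>j<k. \<bar>v j\<bar>)" "(\<Sum>i<m. \<bar>u i\<bar>) > 0"
  shows "\<exists>i<m. \<exists>j<k. (u i > 0 \<and> v j > 0) \<or> (u i < 0 \<and> v j < 0)"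
proof (rule ccontr)
  assume neg: "\<not> ?thesis"
  have aux: False
    if s: "(\<Sum>i<m. u i) = (\<Sum>j<k. v j)" "(\<Sum>i<m. \<bar>u i\<bar>) = (\<Sum>j<k. \<bar>v j\<bar>)"
    and n: "\<not> (\<exists>i<m. \<exists>j<k. (u i > 0 \<and> v j > 0) \<or> (u i < 0 \<and> v j < 0))"
    and i: "i < m" "u i > 0" for u v :: "nat \<Rightarrow> int" and i
  proof -
    have "(\<Sum>j<k. v j) = (\<Sum>j<k. - \<bar>v j\<bar>)"
    proof (rule sum.cong[OF refl])
      fix j assume "j \<in> {..<k}"
      hence "\<not> v j > 0"
        using n i by auto
      thus "v j = - \<bar>v j\<bar>"
        by linarith
    qed
    hence "(\<Sum>i<m. u i + \<bar>u i\<bar>) = 0"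
      using s by (simp add: sum.distrib sum_negf)
    hence "u i + \<bar>u i\<bar> = 0"
      using i by (subst (asm) sum_nonneg_eq_0_iff) (auto dest!: bspec[of _ _ i])
    thus False
      using i by auto
  qed
  obtain i where i: "i < m" "u i \<noteq> 0"
    using assms(3) by (metis abs_zero lessThan_iff less_irrefl sum.neutral)
  show False
  proof (cases "u i > 0")
    case True
    thus ?thesis using aux[OF assms(1,2) neg i(1)] by simp
  next
    case False
    show ?thesis
      by (rule aux[of "\<lambda>i. - u i" "\<lambda>j. - v j" i]) (use assms neg i False in \<open>auto simp: sum_negf\<close>)
  qed
qed

text \<open>Induction on \<open>n\<close>: removing an edge vector brings both l1 norms down to at
  most \<open>n\<close>, unless they are already that small and 0 is removed instead. By parity the
  norms are never \<open>n + 1\<close> and \<open>n\<close>. So either one norm is too large and the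
  other has room to grow by one, or both equal \<open>n + 1\<close> and entries of equal sign shrink
  together.\<close>

lemma bip_point_in_scaled:
  fixes u v :: "nat \<Rightarrow> int"
  assumes "0 < m" "0 < k" "(\<Sum>i<m. u i) = (\<Sum>j<k. v j)"
    "(\<Sum>i<m. \<bar>u i\<bar>) \<le> int n" "(\<Sum>j<k. \<bar>v j\<bar>) \<le> int n"
  shows "bip_point m k u v \<in> (*\<^sub>R) (real n) ` bip_polytope m k"
  using assms(3-)
proof (induction n arbitrary: u v)
  case 0
  have "(\<Sum>i<m. \<bar>u i\<bar>) = 0" "(\<Sum>j<k. \<bar>v j\<bar>) = 0"
    using 0 by (auto intro!: antisym sum_nonneg)
  hence "\<forall>i<m. u i = 0" "\<forall>j<k. v j = 0"
    by (auto simp: sum_nonneg_eq_0_iff)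
  hence "bip_point m k u v = 0"
    by (simp add: bip_point_def)
  thus ?case
    using zero_in_bip_polytope[OF assms(1,2)] by auto
next
  case (Suc n)
  note P = convex_scaled_add[OF convex_bip_polytope]
  \<comment> \<open>One edge vector is removed, lowering \<open>u i\<close> and \<open>v j\<close>
    by 1; the bounds say that the rest fits into the \<open>n\<close>-th dilate. The fact
    \<open>neg\<close> is the mirror image.\<close>
  have pos: "bip_point m k u v \<in> (*\<^sub>R) (real (Suc n)) ` bip_polytope m k"
    if ij: "i < m" "j < k"
      and le: "(\<Sum>i<m. \<bar>u i\<bar>) - \<bar>u i\<bar> + \<bar>u i - 1\<bar> \<le> int n" "(\<Sum>j<k. \<bar>v j\<bar>) - \<bar>v j\<bar> + \<bar>v j - 1\<bar> \<le> int n" for i j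
  proof -
    let ?u = "u(i := u i - 1)" and ?v = "v(j := v j - 1)"
    have "bip_point m k ?u ?v \<in> (*\<^sub>R) (real n) ` bip_polytope m k"
      by (rule Suc.IH) (use Suc.prems ij le in \<open>auto simp only: sum_abs_upd\<close>)
    from P[OF this edge_in_bip_polytope(1)[OF ij]] show ?thesis
      by (simp add: bip_point_upd(2)[OF ij])
  qed
  have neg: "bip_point m k u v \<in> (*\<^sub>R) (real (Suc n)) ` bip_polytope m k"
    if ij: "i < m" "j < k"
      and le: "(\<Sum>i<m. \<bar>u i\<bar>) - \<bar>u i\<bar> + \<bar>u i + 1\<bar> \<le> int n" "(\<Sum>j<k. \<bar>v j\<bar>) - \<bar>v j\<bar> + \<bar>v j + 1\<bar> \<le> int n" for i j
  proof -
    let ?u = "u(i := u i + 1)" and ?v = "v(j := v j + 1)"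
    have "bip_point m k ?u ?v \<in> (*\<^sub>R) (real n) ` bip_polytope m k"
      by (rule Suc.IH) (use Suc.prems ij le in \<open>auto simp only: sum_abs_upd\<close>)
    from P[OF this edge_in_bip_polytope(2)[OF ij]] show ?thesis
      by (simp add: bip_point_upd(1)[OF ij])
  qed
  let ?A = "\<Sum>i<m. \<bar>u i\<bar>" and ?B = "\<Sum>j<k. \<bar>v j\<bar>"
  have "even (?A - ?B)"
    using even_sum_abs_diff[of u "{..<m}"] even_sum_abs_diff[of v "{..<k}"] Suc.prems(1) by auto
  hence "?A - ?B \<noteq> 1" "?A - ?B \<noteq> - 1"
    using odd_one by (metis, metis dvd_minus_iff)
  hence "\<bar>?A - ?B\<bar> \<noteq> 1"
    by linarith
  hence "?A \<le> int n \<and> ?B \<le> int n \<or> ?A = int n + 1 \<and> ?B \<le> int n - 1 \<or>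
      ?B = int n + 1 \<and> ?A \<le> int n - 1 \<or> ?A = int n + 1 \<and> ?B = int n + 1"
    using Suc.prems by auto
  thus ?case
  proof (elim disjE conjE)
    assume "?A \<le> int n" "?B \<le> int n"
    thus ?thesis
      using P[OF Suc.IH[OF Suc.prems(1)] zero_in_bip_polytope[OF assms(1,2)]] by simp
  next
    assume AB: "?A = int n + 1" "?B \<le> int n - 1"
    hence "?A \<noteq> 0"
      by linarith
    then obtain i where i: "i < m" "u i \<noteq> 0"
      by (metis abs_zero lessThan_iff sum.neutral)
    \<comment> \<open>Any index serves on the side of \<open>v\<close>, so 0 is taken: the norm of
      \<open>v\<close> is at most \<open>n - 1\<close> and tolerates a change by one in either
      direction.\<close>
    show ?thesis
      by (cases "u i > 0") (use pos[OF i(1) assms(2)] neg[OF i(1) assms(2)] i AB in linarith)+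
  next
    assume AB: "?B = int n + 1" "?A \<le> int n - 1"
    hence "?B \<noteq> 0"
      by linarith
    then obtain j where j: "j < k" "v j \<noteq> 0"
      by (metis abs_zero lessThan_iff sum.neutral)
    show ?thesis
      by (cases "v j > 0") (use pos[OF assms(1) j(1)] neg[OF assms(1) j(1)] j AB in linarith)+
  next
    assume AB: "?A = int n + 1" "?B = int n + 1"
    then obtain i j where ij: "i < m" "j < k" "(u i > 0 \<and> v j > 0) \<or> (u i < 0 \<and> v j < 0)"
      using exists_same_sign[OF Suc.prems(1)] by auto
    from ij(3) show ?thesis
      by (elim disjE) (use pos[OF ij(1,2)] neg[OF ij(1,2)] AB in linarith)+
  qed
qed

definition norm_lists :: "nat \<Rightarrow> nat \<Rightarrow> int list set" where
  "norm_lists m n = {us. length us = m \<and> sum_list (map abs us) \<le> int n}"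

lemma scaled_lattice_points:
  assumes "0 < m" "0 < k"
  shows "bij_betw (\<lambda>(us, vs). bip_point m k ((!) us) ((!) vs))
     {(us, vs). us \<in> norm_lists m n \<and> vs \<in> norm_lists k n \<and> sum_list us = sum_list vs}
     ((*\<^sub>R) (real n) ` bip_polytope m k \<inter> integer_lattice (bipartite_vertices m k))"
    (is "bij_betw ?f ?S ?T")
proof (rule bij_betwI')
  fix p q assume "p \<in> ?S" "q \<in> ?S"
  then obtain us vs us' vs' where pq: "p = (us, vs)" "q = (us', vs')"
    "length us = m" "length us' = m" "length vs = k" "length vs' = k"
    by (auto simp: norm_lists_def)
  have "us = us' \<and> vs = vs'" if e: "?f p = ?f q"
  proof -
    have "us ! i = us' ! i" if "i < m" for i
      using arg_cong[OF e, of "\<lambda>x. Poly_Mapping.lookup x (Inl i)"] that pq by simp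
    moreover have "vs ! i = vs' ! i" if "i < k" for i
      using arg_cong[OF e, of "\<lambda>x. Poly_Mapping.lookup x (Inr i)"] that pq by simp
    ultimately show ?thesis
      using pq by (auto intro!: nth_equalityI)
  qed
  thus "(?f p = ?f q) = (p = q)"
    using pq by auto
next
  fix p assume "p \<in> ?S"
  then obtain us vs where p: "p = (us, vs)" "length us = m" "length vs = k"
    "sum_list (map abs us) \<le> int n" "sum_list (map abs vs) \<le> int n" "sum_list us = sum_list vs"
    by (auto simp: norm_lists_def)
  have "bip_point m k ((!) us) ((!) vs) \<in> (*\<^sub>R) (real n) ` bip_polytope m k"
    by (rule bip_point_in_scaled[OF assms])
       (use p in \<open>auto simp: sum_list_sum_nth atLeast0LessThan\<close>)
  thus "?f p \<in> ?T"
    using p bip_point_in_lattice by auto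
next
  fix x assume x: "x \<in> ?T"
  define u where "u = (\<lambda>i. \<lfloor>Poly_Mapping.lookup x (Inl i)\<rfloor>)"
  define v where "v = (\<lambda>j. - \<lfloor>Poly_Mapping.lookup x (Inr j)\<rfloor>)"
  have xeq: "x = bip_point m k u v"
    using bip_point_lookup x by (auto simp: u_def v_def)
  obtain y where y: "y \<in> bip_polytope m k" "x = real n *\<^sub>R y"
    using x by auto
  have U: "of_int (u i) = real n * Poly_Mapping.lookup y (Inl i)" if "i < m" for i
    using arg_cong[OF xeq, of "\<lambda>x. Poly_Mapping.lookup x (Inl i)"] that y by simp
  have V: "of_int (v j) = - real n * Poly_Mapping.lookup y (Inr j)" if "j < k" for j
    using arg_cong[OF xeq, of "\<lambda>x. Poly_Mapping.lookup x (Inr j)"] that y by simp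
  have "of_int (\<Sum>i<m. \<bar>u i\<bar>) = real n * (\<Sum>i<m. \<bar>Poly_Mapping.lookup y (Inl i)\<bar>)"
    by (simp add: U sum_distrib_left abs_mult)
  also have "\<dots> \<le> real n * 1"
    by (rule mult_left_mono) (use bip_polytope_bounds[OF y(1)] in auto)
  finally have 1: "(\<Sum>i<m. \<bar>u i\<bar>) \<le> int n"
    by linarith
  have "of_int (\<Sum>j<k. \<bar>v j\<bar>) = real n * (\<Sum>j<k. \<bar>Poly_Mapping.lookup y (Inr j)\<bar>)"
    by (simp add: V sum_distrib_left abs_mult)
  also have "\<dots> \<le> real n * 1"
    by (rule mult_left_mono) (use bip_polytope_bounds[OF y(1)] in auto)
  finally have 2: "(\<Sum>j<k. \<bar>v j\<bar>) \<le> int n"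
    by linarith
  have "of_int ((\<Sum>i<m. u i) - (\<Sum>j<k. v j)) =
      real n * ((\<Sum>i<m. Poly_Mapping.lookup y (Inl i)) + (\<Sum>j<k. Poly_Mapping.lookup y (Inr j)))"
    by (simp add: U V sum_distrib_left algebra_simps sum_negf)
  also have "\<dots> = 0"
    using bip_polytope_bounds(1)[OF y(1)] by simp
  finally have 3: "(\<Sum>i<m. u i) = (\<Sum>j<k. v j)"
    by linarith
  have "(map u [0..<m], map v [0..<k]) \<in> ?S"
    using 1 2 3 by (simp add: norm_lists_def sum_list_sum_nth atLeast0LessThan)
  moreover have "x = ?f (map u [0..<m], map v [0..<k])"
    by (auto simp: xeq intro!: bip_point_cong)
  ultimately show "\<exists>p\<in>?S. x = ?f p"
    by blast
qed

section \<open>Counting lattice points by coordinate sum\<close>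

definition slice_lists :: "nat \<Rightarrow> nat \<Rightarrow> nat \<Rightarrow> int list set" where
  "slice_lists m p q = {us \<in> norm_lists m (p + q). sum_list us = int p - int q}"

text \<open>Numbers with generating function (1 - xy)^a / ((1 - x)(1 - y))^(a + 1): the prefix sums
  in p and q contribute x / (1 - x) and y / (1 - y), and 1 + x / (1 - x) + y / (1 - y) = (1 - xy) /
  ((1 - x)(1 - y)).\<close>

fun slice_count :: "nat \<Rightarrow> nat \<Rightarrow> nat \<Rightarrow> nat" where
  "slice_count 0 p q = 1"
| "slice_count (Suc a) p q =
     slice_count a p q + (\<Sum>p'<p. slice_count a p' q) + (\<Sum>q'<q. slice_count a p q')"

lemma abs_sum_list_le: "\<bar>sum_list us\<bar> \<le> sum_list (map abs us)" for us :: "int list"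
  by (induction us) auto

text \<open>Sum p - q with norm at most p + q means that the positive entries add up to at most p
  and the negative ones to at least -q. A positive first entry c therefore uses up c of p, leaving
  \<open>p' = p - c\<close>, and a negative one uses up part of q.\<close>

lemma slice_lists_Suc:
  "slice_lists (Suc m) p q = (#) 0 ` slice_lists m p q \<union>
     (\<Union>p'<p. (#) (int p - int p') ` slice_lists m p' q) \<union>
     (\<Union>q'<q. (#) (int q' - int q) ` slice_lists m p q')" (is "?L = ?R")
proof (rule set_eqI, rule iffI)
  fix us assume "us \<in> ?L"
  then obtain c ws where us: "us = c # ws" "length ws = m" "c + sum_list ws = int p - int q"
    "\<bar>c\<bar> + sum_list (map abs ws) \<le> int p + int q"
    by (auto simp: slice_lists_def norm_lists_def length_Suc_conv)
  have b: "\<bar>sum_list ws\<bar> \<le> sum_list (map abs ws)"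
    by (rule abs_sum_list_le)
  consider "c = 0" | "c > 0" | "c < 0"
    by linarith
  thus "us \<in> ?R"
  proof cases
    case 1
    thus ?thesis
      using us by (auto simp: slice_lists_def norm_lists_def)
  next
    case 2
    have "nat (int p - c) < p" "ws \<in> slice_lists m (nat (int p - c)) q" "c = int p - int (nat (int p - c))"
      using 2 us b by (auto simp: slice_lists_def norm_lists_def)
    thus ?thesis
      using us(1) by blast
  next
    case 3
    have "nat (int q + c) < q" "ws \<in> slice_lists m p (nat (int q + c))" "c = int (nat (int q + c)) - int q"
      using 3 us b by (auto simp: slice_lists_def norm_lists_def)
    thus ?thesis
      using us(1) by blast
  qed
next
  fix us assume "us \<in> ?R"
  thus "us \<in> ?L"
    by (auto simp: slice_lists_def norm_lists_def)
qed

lemma finite_slice_lists: "finite (slice_lists m p q)"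
proof (induction m arbitrary: p q)
  case 0
  have "slice_lists 0 p q \<subseteq> {[]}"
    by (auto simp: slice_lists_def norm_lists_def)
  thus ?case
    using finite_subset by blast
qed (simp add: slice_lists_Suc)

lemma card_slice_lists: "card (slice_lists (Suc a) p q) = slice_count a p q"
proof (induction a arbitrary: p q)
  case 0
  have "slice_lists (Suc 0) p q = {[int p - int q]}"
    by (auto simp: slice_lists_def norm_lists_def length_Suc_conv)
  thus ?case
    by simp
next
  case (Suc a)
  let ?X = "(#) 0 ` slice_lists (Suc a) p q"
  let ?Y = "\<Union>p'<p. (#) (int p - int p') ` slice_lists (Suc a) p' q"
  let ?Z = "\<Union>q'<q. (#) (int q' - int q) ` slice_lists (Suc a) p q'"
  have fin: "finite ?X" "finite ?Y" "finite ?Z"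
    by (auto simp: finite_slice_lists)
  have "card ?X = slice_count a p q"
    by (simp add: card_image Suc)
  moreover have "card ?Y = (\<Sum>p'<p. slice_count a p' q)"
    by (subst card_UN_disjoint) (auto simp: finite_slice_lists card_image Suc)
  moreover have "card ?Z = (\<Sum>q'<q. slice_count a p q')"
    by (subst card_UN_disjoint) (auto simp: finite_slice_lists card_image Suc)
  moreover have "card (?X \<union> ?Y \<union> ?Z) = card ?X + card ?Y + card ?Z"
    using fin by (subst card_Un_disjoint card_Un_disjoint, auto)+
  ultimately show ?case
    by (simp add: slice_lists_Suc[of "Suc a"])
qed

lemma even_norm_list: "even (sum_list (map abs us) - sum_list us)" for us :: "int list"
  by (induction us) (auto simp: abs_if)

text \<open>A pair whose common sum has the parity of \<open>n\<close> has sum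
  \<open>p - (n - p)\<close> for exactly one \<open>p \<le> n\<close>, which gives
  \<open>e n\<close>. With the other parity the norms cannot equal \<open>n\<close>, so the pair
  already belongs to \<open>n - 1\<close>, where the parity matches. This is the origin of the
  factor 1 + t of the Ehrhart series.\<close>

lemma card_norm_pairs:
  fixes a b :: nat
  defines "S \<equiv> \<lambda>n. {(us, vs). us \<in> norm_lists (Suc a) n \<and> vs \<in> norm_lists (Suc b) n \<and> sum_list us = sum_list vs}"
  defines "e \<equiv> \<lambda>n. \<Sum>p\<le>n. slice_count a p (n - p) * slice_count b p (n - p)"
  shows "card (S n) = e n + (if n = 0 then 0 else e (n - 1))"
proof -
  define E where "E = (\<lambda>n. \<Union>p\<le>n. slice_lists (Suc a) p (n - p) \<times> slice_lists (Suc b) p (n - p))"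
  have finE: "finite (E n)" for n
    by (simp add: E_def finite_slice_lists)
  have E_iff: "x \<in> E n \<longleftrightarrow> x \<in> S n \<and> even (sum_list (fst x) - int n)" for n x
  proof
    assume "x \<in> E n"
    thus "x \<in> S n \<and> even (sum_list (fst x) - int n)"
      by (auto simp: E_def S_def slice_lists_def of_nat_diff)
  next
    assume R: "x \<in> S n \<and> even (sum_list (fst x) - int n)"
    obtain us vs where x: "x = (us, vs)"
      by (cases x)
    from R x have ev: "even (sum_list us - int n)" and s: "sum_list us = sum_list vs"
      and u: "us \<in> norm_lists (Suc a) n" and v: "vs \<in> norm_lists (Suc b) n"
      by (auto simp: S_def)
    have "even (sum_list us + int n)"
      using ev by simp
    then obtain c where c: "sum_list us + int n = 2 * c"
      by (elim evenE)
    have "\<bar>sum_list us\<bar> \<le> int n"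
      using abs_sum_list_le[of us] u by (auto simp: norm_lists_def)
    with c have "0 \<le> c" "c \<le> int n"
      by auto
    with c have p: "nat c \<le> n" "sum_list us = int (nat c) - int (n - nat c)"
      by auto
    with u v s x have "x \<in> slice_lists (Suc a) (nat c) (n - nat c) \<times> slice_lists (Suc b) (nat c) (n - nat c)"
      by (auto simp: slice_lists_def)
    with p show "x \<in> E n"
      by (auto simp: E_def)
  qed
  have cardE: "card (E n) = e n" for n
    unfolding E_def e_def
  proof (subst card_UN_disjoint)
    show "\<forall>i\<in>{..n}. \<forall>j\<in>{..n}. i \<noteq> j \<longrightarrow>
       slice_lists (Suc a) i (n - i) \<times> slice_lists (Suc b) i (n - i) \<inter>
       slice_lists (Suc a) j (n - j) \<times> slice_lists (Suc b) j (n - j) = {}"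
      by (auto simp: slice_lists_def of_nat_diff)
  qed (simp_all add: finite_slice_lists card_cartesian_product card_slice_lists)
  have mono: "S (n - 1) \<subseteq> S n" for n
    by (auto simp: S_def norm_lists_def)
  show ?thesis
  proof (cases n)
    case 0
    have "sum_list us = 0" if "us \<in> norm_lists (Suc a) 0" for us
      using abs_sum_list_le[of us] that unfolding norm_lists_def by simp linarith
    hence "S 0 = E 0"
      by (auto simp: E_iff S_def)
    thus ?thesis
      using 0 cardE by simp
  next
    case (Suc k)
    have "x \<in> E (Suc k) \<union> E k" if x: "x \<in> S (Suc k)" for x
    proof (cases "even (sum_list (fst x) - int (Suc k))")
      case True
      thus ?thesis using x E_iff by auto
    next
      case False
      have "even (sum_list (map abs (fst x)) - sum_list (fst x))" "even (sum_list (map abs (snd x)) - sum_list (snd x))"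
        by (rule even_norm_list)+
      hence "sum_list (map abs (fst x)) \<noteq> int (Suc k)" "sum_list (map abs (snd x)) \<noteq> int (Suc k)"
        using False x by (auto simp: S_def)
      hence "x \<in> S k"
        using x by (auto simp: S_def norm_lists_def)
      thus ?thesis
        using False by (auto simp: E_iff)
    qed
    hence "S (Suc k) \<subseteq> E (Suc k) \<union> E k"
      by blast
    moreover have "E (Suc k) \<union> E k \<subseteq> S (Suc k)"
      using mono[of "Suc k"] by (auto simp: E_iff)
    ultimately have "S (Suc k) = E (Suc k) \<union> E k"
      by blast
    moreover have "E (Suc k) \<inter> E k = {}"
      by (auto simp: E_iff)
    ultimately have "card (S (Suc k)) = card (E (Suc k)) + card (E k)"
      by (simp add: card_Un_disjoint finE)
    thus ?thesis
      using Suc by (simp add: cardE)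
  qed
qed

lemma ehrhart_series_bipartite:
  "ehrhart_series (bipartite_vertices (Suc a) (Suc b)) (bip_polytope (Suc a) (Suc b)) =
     (1 + fps_X) * Abs_fps (\<lambda>n. \<Sum>p\<le>n. real (slice_count a p (n - p)) * real (slice_count b p (n - p)))"
  unfolding ehrhart_series_def
  by (rule fps_ext) (simp add: bij_betw_same_card[OF scaled_lattice_points, symmetric] card_norm_pairs
      distrib_right)

subsection \<open>Meixner expansion of the Ehrhart series\<close>

text \<open>The series \<Sum> \<open>f p * fps_X ^ p\<close> with power series \<open>f p\<close>,
  given through its finite coefficient sums. It acts as summation against the weight t^p.\<close>

definition fps_psum :: "(nat \<Rightarrow> 'a::comm_ring_1 fps) \<Rightarrow> 'a fps" where
  "fps_psum f = Abs_fps (\<lambda>n. \<Sum>p\<le>n. fps_nth (f p) (n - p))"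

lemma fps_psum_add: "fps_psum (\<lambda>p. f p + g p) = fps_psum f + fps_psum g"
  by (rule fps_ext) (simp add: fps_psum_def sum.distrib)

lemma fps_psum_sum: "fps_psum (\<lambda>p. \<Sum>i\<in>A. f i p) = (\<Sum>i\<in>A. fps_psum (f i))"
  by (rule fps_ext) (simp add: fps_psum_def fps_sum_nth sum.swap[of _ A])

lemma fps_psum_cmult: "fps_psum (\<lambda>p. c * f p) = c * fps_psum f"
proof (rule fps_ext)
  fix n
  have *: "(\<Sum>p\<le>n. \<Sum>i\<le>n - p. fps_nth c i * fps_nth (f p) (n - p - i)) = (\<Sum>i\<le>n. \<Sum>p\<le>n - i. fps_nth c i * fps_nth (f p) (n - p - i))"
  proof -
    have "{..n - p} = {i. i \<in> {..n} \<and> p + i \<le> n}" "{..n - p} = {i. i \<in> {..n} \<and> i + p \<le> n}" if "p \<le> n" for p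
      using that by auto
    thus ?thesis
      using sum.swap_restrict[of "{..n}" "{..n}" "\<lambda>p i. fps_nth c i * fps_nth (f p) (n - p - i)" "\<lambda>p i. p + i \<le> n"]
      by simp
  qed
  show "fps_nth (fps_psum (\<lambda>p. c * f p)) n = fps_nth (c * fps_psum f) n"
    using * by (simp add: fps_psum_def fps_mult_nth sum_distrib_left atLeast0AtMost add.commute)
qed

text \<open>A shift of the summation index becomes a factor \<open>fps_X\<close>; the inner product
  recursions all come from this.\<close>

lemma fps_psum_Suc: "fps_psum f = f 0 + fps_X * fps_psum (\<lambda>p. f (Suc p))"
proof (rule fps_ext)
  fix n
  show "fps_nth (fps_psum f) n = fps_nth (f 0 + fps_X * fps_psum (\<lambda>p. f (Suc p))) n"
    by (cases n) (simp_all add: fps_psum_def sum.atMost_Suc_shift del: sum.atMost_Suc)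
qed

text \<open>The mean t / (1 - t) of p under the geometric weight, so that
  \<open>meixner 1 p\<close>, which equals \<open>p - fps_tau\<close>, has mean zero.\<close>

abbreviation fps_tau :: "real fps" where
  "fps_tau \<equiv> fps_X * inverse (1 - fps_X)"

text \<open>Up to scaling, the Meixner polynomials orthogonal for the geometric weight \<open>t\<^sup>p\<close>.\<close>

fun meixner :: "nat \<Rightarrow> nat \<Rightarrow> real fps" where
  "meixner 0 p = 1"
| "meixner (Suc k) p = (\<Sum>p'<p. meixner k p') - fps_tau * meixner k p"

lemma one_minus_fps_tau: "(1 - fps_X) * fps_tau = fps_X"
  using inverse_mult_eq_1'[of "1 - fps_X :: real fps"] by (simp add: mult.left_commute)

lemma meixner_0: "(1 - fps_X) * meixner (Suc k) 0 + fps_X * meixner k 0 = 0"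
proof -
  have "(1 - fps_X) * meixner (Suc k) 0 = - ((1 - fps_X) * fps_tau) * meixner k 0"
    by (simp add: algebra_simps)
  thus ?thesis
    by (simp only: one_minus_fps_tau) simp
qed

text \<open>One combination at \<open>Suc p\<close> equals another at \<open>p\<close>, and by
  \<open>meixner_0\<close> the first one vanishes at 0. Summed against t^p, the two therefore differ
  by exactly one factor \<open>fps_X\<close>.\<close>

lemma meixner_step:
  "(1 - fps_X) * meixner (Suc k) (Suc p) + fps_X * meixner k (Suc p) =
   (1 - fps_X) * meixner (Suc k) p + meixner k p"
proof -
  have "(1 - fps_X) * (meixner (Suc k) (Suc p) - meixner (Suc k) p)
      = (1 - fps_X) * meixner k p - ((1 - fps_X) * fps_tau) * (meixner k (Suc p) - meixner k p)"
    by (simp add: algebra_simps)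
  thus ?thesis
    unfolding one_minus_fps_tau by (simp add: algebra_simps)
qed

definition meixner_inner :: "nat \<Rightarrow> nat \<Rightarrow> real fps" where
  "meixner_inner k l = fps_psum (\<lambda>p. meixner k p * meixner l p)"

lemma one_minus_fps_X_nonzero: "(1 - fps_X :: real fps) \<noteq> 0"
proof
  assume "(1 - fps_X :: real fps) = 0"
  hence "fps_nth (1 - fps_X :: real fps) 0 = fps_nth 0 0"
    by simp
  thus False
    by simp
qed

text \<open>By \<open>meixner_step\<close> the sum of \<open>U k p * U l p\<close> is
  \<open>fps_X\<close> times that of \<open>V k p * V l p\<close>. After expanding both, the mixed
  inner products carry the same coefficient \<open>(1 - fps_X) * fps_X\<close> and cancel.\<close>

lemma meixner_inner_Suc:
  "(1 - fps_X) ^ 2 * meixner_inner (Suc k) (Suc l) = fps_X * meixner_inner k l"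
proof -
  define U where "U = (\<lambda>k p. (1 - fps_X) * meixner (Suc k) p + fps_X * meixner k p)"
  define V where "V = (\<lambda>k p. (1 - fps_X) * meixner (Suc k) p + meixner k p)"
  have U0: "U k 0 = 0" and US: "U k (Suc p) = V k p" for k p
    unfolding U_def V_def by (rule meixner_0, rule meixner_step)
  have "fps_psum (\<lambda>p. U k p * U l p) = fps_X * fps_psum (\<lambda>p. V k p * V l p)"
    by (subst fps_psum_Suc) (simp add: U0 US)
  moreover have "fps_psum (\<lambda>p. U k p * U l p) =
     (1 - fps_X)^2 * meixner_inner (Suc k) (Suc l) + ((1 - fps_X) * fps_X) * meixner_inner (Suc k) l
     + ((1 - fps_X) * fps_X) * meixner_inner k (Suc l) + fps_X ^ 2 * meixner_inner k l"
    unfolding U_def meixner_inner_def fps_psum_cmult[symmetric] fps_psum_add[symmetric]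
    by (rule arg_cong[of _ _ fps_psum]) (simp add: fun_eq_iff algebra_simps power2_eq_square del: meixner.simps)
  moreover have "fps_psum (\<lambda>p. V k p * V l p) =
     (1 - fps_X)^2 * meixner_inner (Suc k) (Suc l) + (1 - fps_X) * meixner_inner (Suc k) l
     + (1 - fps_X) * meixner_inner k (Suc l) + meixner_inner k l"
    unfolding V_def meixner_inner_def fps_psum_cmult[symmetric] fps_psum_add[symmetric]
    by (rule arg_cong[of _ _ fps_psum]) (simp add: fun_eq_iff algebra_simps power2_eq_square del: meixner.simps)
  ultimately have "(1 - fps_X) * ((1 - fps_X) ^ 2 * meixner_inner (Suc k) (Suc l)) = (1 - fps_X) * (fps_X * meixner_inner k l)"
    by (simp add: algebra_simps power2_eq_square)
  thus ?thesis
    using one_minus_fps_X_nonzero by (metis mult_left_cancel)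
qed

lemma meixner_inner_Suc_0: "meixner_inner (Suc k) 0 = 0"
proof -
  define U where "U = (\<lambda>p. (1 - fps_X) * meixner (Suc k) p + fps_X * meixner k p)"
  define V where "V = (\<lambda>p. (1 - fps_X) * meixner (Suc k) p + meixner k p)"
  have U0: "U 0 = 0" and US: "U (Suc p) = V p" for p
    unfolding U_def V_def by (rule meixner_0, rule meixner_step)
  have "fps_psum U = fps_X * fps_psum V"
    by (subst fps_psum_Suc) (simp add: U0 US)
  moreover have "fps_psum U = (1 - fps_X) * meixner_inner (Suc k) 0 + fps_X * meixner_inner k 0"
    unfolding U_def meixner_inner_def fps_psum_cmult[symmetric] fps_psum_add[symmetric] by simp
  moreover have "fps_psum V = (1 - fps_X) * meixner_inner (Suc k) 0 + meixner_inner k 0"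
    unfolding V_def meixner_inner_def fps_psum_cmult[symmetric] fps_psum_add[symmetric] by simp
  ultimately have "(1 - fps_X) * ((1 - fps_X) * meixner_inner (Suc k) 0) = 0"
    by (simp add: algebra_simps)
  thus ?thesis
    using one_minus_fps_X_nonzero by simp
qed

lemma meixner_inner_commute: "meixner_inner k l = meixner_inner l k"
  by (simp add: meixner_inner_def mult.commute)

lemma meixner_inner_0: "(1 - fps_X) * meixner_inner 0 0 = 1"
proof -
  have "meixner_inner 0 0 = 1 + fps_X * meixner_inner 0 0"
    unfolding meixner_inner_def by (subst fps_psum_Suc) simp
  thus ?thesis
    by (simp add: algebra_simps)
qed

lemma meixner_orthogonal: "k \<noteq> l \<Longrightarrow> meixner_inner k l = 0"
proof (induction k arbitrary: l)
  case 0
  then show ?case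
    by (cases l) (auto simp: meixner_inner_Suc_0 meixner_inner_commute[of 0 "Suc _"])
next
  case (Suc k)
  show ?case
  proof (cases l)
    case 0
    thus ?thesis by (simp add: meixner_inner_Suc_0)
  next
    case (Suc l')
    thus ?thesis
      using meixner_inner_Suc[of k l'] Suc.IH[of l'] Suc.prems one_minus_fps_X_nonzero by simp
  qed
qed

lemma meixner_inner_diag: "(1 - fps_X) ^ (2 * k + 1) * meixner_inner k k = fps_X ^ k"
proof (induction k)
  case 0
  show ?case using meixner_inner_0 by simp
next
  case (Suc k)
  have "(1 - fps_X) ^ (2 * Suc k + 1) * meixner_inner (Suc k) (Suc k) =
        (1 - fps_X) ^ (2 * k + 1) * ((1 - fps_X) ^ 2 * meixner_inner (Suc k) (Suc k))"
    by (simp add: power2_eq_square mult_ac)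
  also have "\<dots> = fps_X * ((1 - fps_X) ^ (2 * k + 1) * meixner_inner k k)"
    by (simp only: meixner_inner_Suc mult.left_commute)
  finally show ?case
    by (simp only: Suc power_Suc)
qed

text \<open>The i-th power, applied to 1, of the operator that adds the prefix sums in p and in q
  and subtracts \<open>2 * fps_tau\<close> times the function. It is the sum of the two commuting
  one-variable operators behind \<open>meixner\<close>, so its powers expand binomially;
  \<open>meixner2_Suc\<close> is one application.\<close>

definition meixner2 :: "nat \<Rightarrow> nat \<Rightarrow> nat \<Rightarrow> real fps" where
  "meixner2 i p q = (\<Sum>k\<le>i. of_nat (i choose k) * (meixner k p * meixner (i - k) q))"

lemma sum_choose_Suc:
  fixes f :: "nat \<Rightarrow> 'a::comm_semiring_1"
  shows "(\<Sum>k\<le>Suc i. of_nat (Suc i choose k) * f k) =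
         (\<Sum>k\<le>i. of_nat (i choose k) * f (Suc k)) + (\<Sum>k\<le>i. of_nat (i choose k) * f k)"
proof -
  have "(\<Sum>k\<le>Suc i. of_nat (Suc i choose k) * f k) =
        f 0 + (\<Sum>k\<le>i. of_nat (Suc i choose Suc k) * f (Suc k))"
    by (subst sum.atMost_Suc_shift) simp
  also have "\<dots> = (\<Sum>k\<le>i. of_nat (i choose k) * f (Suc k)) +
       (f 0 + (\<Sum>k\<le>i. of_nat (i choose Suc k) * f (Suc k)))"
    by (simp add: algebra_simps sum.distrib)
  also have "f 0 + (\<Sum>k\<le>i. of_nat (i choose Suc k) * f (Suc k)) =
       (\<Sum>k\<le>Suc i. of_nat (i choose k) * f k)"
    by (subst sum.atMost_Suc_shift) simp
  finally show ?thesis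
    by (simp add: binomial_eq_0 del: binomial_Suc_Suc)
qed

lemma meixner2_Suc:
  "meixner2 (Suc i) p q = (\<Sum>p'<p. meixner2 i p' q) + (\<Sum>q'<q. meixner2 i p q') - 2 * fps_tau * meixner2 i p q"
proof -
  have "meixner2 (Suc i) p q =
      (\<Sum>k\<le>i. of_nat (i choose k) * (meixner (Suc k) p * meixner (i - k) q)) +
      (\<Sum>k\<le>i. of_nat (i choose k) * (meixner k p * meixner (Suc (i - k)) q))"
    unfolding meixner2_def by (subst sum_choose_Suc) (simp add: Suc_diff_le del: meixner.simps)
  also have "(\<Sum>k\<le>i. of_nat (i choose k) * (meixner (Suc k) p * meixner (i - k) q)) =
      (\<Sum>p'<p. meixner2 i p' q) - fps_tau * meixner2 i p q"
    unfolding meixner2_def sum.swap[of _ _ "{..<p}"]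
    by (simp add: sum_subtractf[symmetric] sum_distrib_left sum_distrib_right algebra_simps)
  also have "(\<Sum>k\<le>i. of_nat (i choose k) * (meixner k p * meixner (Suc (i - k)) q)) =
      (\<Sum>q'<q. meixner2 i p q') - fps_tau * meixner2 i p q"
    unfolding meixner2_def sum.swap[of _ _ "{..<q}"]
    by (simp add: sum_subtractf[symmetric] sum_distrib_left sum_distrib_right algebra_simps)
  finally show ?thesis
    by simp
qed

text \<open>The recursion of \<open>slice_count\<close> is the operator of
  \<open>meixner2_Suc\<close> plus multiplication by \<open>1 + 2 * fps_tau\<close>. These commute,
  so the a-th power expands by the binomial theorem.\<close>

lemma slice_count_meixner:
  "of_nat (slice_count a p q) = (\<Sum>i\<le>a. of_nat (a choose i) * ((1 + 2 * fps_tau) ^ (a - i) * meixner2 i p q))"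
proof (induction a arbitrary: p q)
  case 0
  show ?case by (simp add: meixner2_def)
next
  case (Suc a)
  let ?z = "1 + 2 * fps_tau"
  let ?f = "\<lambda>p q. (\<Sum>i\<le>a. of_nat (a choose i) * (?z ^ (a - i) * meixner2 i p q))"
  have "(\<Sum>i\<le>Suc a. of_nat (Suc a choose i) * (?z ^ (Suc a - i) * meixner2 i p q)) =
     (\<Sum>i\<le>a. of_nat (a choose i) * (?z ^ (a - i) * meixner2 (Suc i) p q)) +
     (\<Sum>i\<le>a. of_nat (a choose i) * (?z ^ Suc (a - i) * meixner2 i p q))"
    by (subst sum_choose_Suc) (simp add: Suc_diff_le)
  also have "(\<Sum>i\<le>a. of_nat (a choose i) * (?z ^ (a - i) * meixner2 (Suc i) p q)) =
     (\<Sum>p'<p. ?f p' q) + (\<Sum>q'<q. ?f p q') - 2 * fps_tau * ?f p q"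
    unfolding meixner2_Suc sum.swap[of _ _ "{..<p}"] sum.swap[of _ _ "{..<q}"]
    by (simp add: sum_subtractf[symmetric] sum.distrib[symmetric] sum_distrib_left sum_distrib_right algebra_simps)
  also have "(\<Sum>i\<le>a. of_nat (a choose i) * (?z ^ Suc (a - i) * meixner2 i p q)) = ?z * ?f p q"
    by (simp add: sum_distrib_left mult_ac)
  finally have eq: "(\<Sum>i\<le>Suc a. of_nat (Suc a choose i) * (?z ^ (Suc a - i) * meixner2 i p q)) =
     (\<Sum>p'<p. ?f p' q) + (\<Sum>q'<q. ?f p q') - 2 * fps_tau * ?f p q + ?z * ?f p q" .
  have alg: "F + A + B = A + B - 2 * t * F + (1 + 2 * t) * F" for F A B t :: "real fps"
    by (simp add: algebra_simps)
  show ?case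
    unfolding eq slice_count.simps of_nat_add of_nat_sum Suc.IH by (rule alg)
qed

definition fps_psum2 :: "(nat \<Rightarrow> nat \<Rightarrow> real fps) \<Rightarrow> real fps" where
  "fps_psum2 f = fps_psum (\<lambda>p. fps_psum (f p))"

lemma fps_psum2_sum: "fps_psum2 (\<lambda>p q. \<Sum>i\<in>A. f i p q) = (\<Sum>i\<in>A. fps_psum2 (f i))"
  by (simp add: fps_psum2_def fps_psum_sum)

lemma fps_psum2_cmult: "fps_psum2 (\<lambda>p q. c * f p q) = c * fps_psum2 f"
  by (simp add: fps_psum2_def fps_psum_cmult)

lemma fps_psum2_prod: "fps_psum2 (\<lambda>p q. f p * g q) = fps_psum f * fps_psum g"
  by (simp add: fps_psum2_def fps_psum_cmult mult.commute[of _ "fps_psum g"])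

text \<open>Orthogonality in each variable leaves only the terms with l = k and i - k = j - l, hence
  nothing unless i = j. Each surviving term is t^i / (1 - t)^(2i + 2) times a squared binomial
  coefficient, and the squares add up to the central one.\<close>

lemma meixner2_inner:
  "(1 - fps_X) ^ (2 * i + 2) * fps_psum2 (\<lambda>p q. meixner2 i p q * meixner2 j p q) =
     (if i = j then of_nat ((2 * i) choose i) * fps_X ^ i else 0)"
proof -
  have "fps_psum2 (\<lambda>p q. meixner2 i p q * meixner2 j p q) =
    fps_psum2 (\<lambda>p q. \<Sum>k\<le>i. \<Sum>l\<le>j. (of_nat (i choose k) * of_nat (j choose l)) *
        ((meixner k p * meixner l p) * (meixner (i - k) q * meixner (j - l) q)))"
    by (simp add: meixner2_def sum_product mult_ac)
  also have "\<dots> = (\<Sum>k\<le>i. \<Sum>l\<le>j. (of_nat (i choose k) * of_nat (j choose l)) *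
        (meixner_inner k l * meixner_inner (i - k) (j - l)))"
    unfolding fps_psum2_sum fps_psum2_cmult fps_psum2_prod meixner_inner_def ..
  also have "\<dots> = (\<Sum>k\<le>i. \<Sum>l\<le>j. if l = k then (of_nat (i choose k) * of_nat (j choose l)) *
        (meixner_inner k l * meixner_inner (i - k) (j - l)) else 0)"
    by (intro sum.cong refl) (auto simp: meixner_orthogonal)
  also have "\<dots> = (\<Sum>k\<le>i. if k \<le> j then (of_nat (i choose k) * of_nat (j choose k)) *
        (meixner_inner k k * meixner_inner (i - k) (j - k)) else 0)"
    by (simp add: sum.delta)
  finally have *: "fps_psum2 (\<lambda>p q. meixner2 i p q * meixner2 j p q) = \<dots>" .
  show ?thesis
  proof (cases "i = j")
    case False
    have "fps_psum2 (\<lambda>p q. meixner2 i p q * meixner2 j p q) = 0"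
      unfolding * by (rule sum.neutral) (use False in \<open>auto intro!: meixner_orthogonal\<close>)
    thus ?thesis
      using False by simp
  next
    case True
    have d: "(1 - fps_X) ^ (2 * i + 2) * (meixner_inner k k * meixner_inner (i - k) (i - k)) = fps_X ^ i"
      if "k \<le> i" for k
    proof -
      have "2 * i + 2 = (2 * k + 1) + (2 * (i - k) + 1)"
        using that by simp
      hence "(1 - fps_X :: real fps) ^ (2 * i + 2) = (1 - fps_X) ^ (2 * k + 1) * (1 - fps_X) ^ (2 * (i - k) + 1)"
        by (simp only: power_add)
      hence "(1 - fps_X) ^ (2 * i + 2) * (meixner_inner k k * meixner_inner (i - k) (i - k)) =
          ((1 - fps_X) ^ (2 * k + 1) * meixner_inner k k) * ((1 - fps_X) ^ (2 * (i - k) + 1) * meixner_inner (i - k) (i - k))"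
        by (simp only: mult_ac)
      also have "\<dots> = fps_X ^ i"
        using that by (simp only: meixner_inner_diag) (simp add: power_add[symmetric])
      finally show ?thesis .
    qed
    have "(1 - fps_X) ^ (2 * i + 2) * fps_psum2 (\<lambda>p q. meixner2 i p q * meixner2 j p q) =
      (\<Sum>k\<le>i. (of_nat (i choose k) * of_nat (i choose k)) *
        ((1 - fps_X) ^ (2 * i + 2) * (meixner_inner k k * meixner_inner (i - k) (i - k))))"
    proof -
      have "fps_psum2 (\<lambda>p q. meixner2 i p q * meixner2 j p q) =
        (\<Sum>k\<le>i. (of_nat (i choose k) * of_nat (i choose k)) * (meixner_inner k k * meixner_inner (i - k) (i - k)))"
        unfolding * using True by (intro sum.cong) auto
      thus ?thesis
        by (simp only: sum_distrib_left mult_ac)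
    qed
    also have "\<dots> = (\<Sum>k\<le>i. (of_nat (i choose k) * of_nat (i choose k)) * fps_X ^ i)"
      by (intro sum.cong refl) (simp only: atMost_iff d)
    also have "\<dots> = of_nat (\<Sum>k\<le>i. (i choose k) * (i choose k)) * fps_X ^ i"
      by (simp add: sum_distrib_right)
    finally show ?thesis
      using True by (simp add: choose_square_sum[symmetric] power2_eq_square)
  qed
qed

text \<open>By \<open>meixner2_inner\<close> the cross terms with i \<noteq> j vanish. The remaining
  powers of 1 - t are absorbed by (1 - t) (1 + 2 t / (1 - t)) = 1 + t.\<close>

lemma slice_count_psum2:
  "(1 - fps_X) ^ (a + b + 2) * fps_psum2 (\<lambda>p q. of_nat (slice_count a p q) * of_nat (slice_count b p q)) =
   (\<Sum>i\<le>min a b. of_nat (((2 * i) choose i) * (a choose i) * (b choose i)) * fps_X ^ i * (1 + fps_X) ^ (a + b - 2 * i))"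
proof -
  let ?z = "1 + 2 * fps_tau"
  have z: "(1 - fps_X) * ?z = 1 + fps_X"
  proof -
    have "(1 - fps_X) * ?z = (1 - fps_X) + 2 * ((1 - fps_X) * fps_tau)"
      by (simp add: algebra_simps)
    thus ?thesis
      unfolding one_minus_fps_tau by simp
  qed
  let ?c = "\<lambda>i j. of_nat (a choose i) * of_nat (b choose j) * (?z ^ (a - i) * ?z ^ (b - j))"
  have "fps_psum2 (\<lambda>p q. of_nat (slice_count a p q) * of_nat (slice_count b p q)) =
    fps_psum2 (\<lambda>p q. \<Sum>i\<le>a. \<Sum>j\<le>b. ?c i j * (meixner2 i p q * meixner2 j p q))"
    unfolding slice_count_meixner sum_product by (simp add: mult_ac)
  also have "\<dots> = (\<Sum>i\<le>a. \<Sum>j\<le>b. ?c i j * fps_psum2 (\<lambda>p q. meixner2 i p q * meixner2 j p q))"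
    unfolding fps_psum2_sum fps_psum2_cmult ..
  finally have "(1 - fps_X) ^ (a + b + 2) * fps_psum2 (\<lambda>p q. of_nat (slice_count a p q) * of_nat (slice_count b p q)) =
     (\<Sum>i\<le>a. \<Sum>j\<le>b. (1 - fps_X) ^ (a + b + 2) * (?c i j * fps_psum2 (\<lambda>p q. meixner2 i p q * meixner2 j p q)))"
    by (simp only: sum_distrib_left)
  also have "\<dots> = (\<Sum>i\<le>a. \<Sum>j\<le>b. if j = i then
     of_nat (((2 * i) choose i) * (a choose i) * (b choose i)) * fps_X ^ i * (1 + fps_X) ^ (a + b - 2 * i) else 0)"
  proof (intro sum.cong refl)
    fix i j assume ij: "i \<in> {..a}" "j \<in> {..b}"
    let ?P = "fps_psum2 (\<lambda>p q. meixner2 i p q * meixner2 j p q)"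
    show "(1 - fps_X) ^ (a + b + 2) * (?c i j * ?P) = (if j = i then
     of_nat (((2 * i) choose i) * (a choose i) * (b choose i)) * fps_X ^ i * (1 + fps_X) ^ (a + b - 2 * i) else 0)"
    proof (cases "j = i")
      case False
      have "(1 - fps_X) ^ (2 * i + 2) * ?P = 0"
        using meixner2_inner[of i j] False by simp
      moreover have "(1 - fps_X :: real fps) ^ (2 * i + 2) \<noteq> 0"
        using one_minus_fps_X_nonzero by (rule power_not_zero)
      ultimately have "?P = 0"
        by (simp only: mult_eq_0_iff simp_thms)
      thus ?thesis
        using False by simp
    next
      case True
      have e1: "(1 - fps_X :: real fps) ^ (a + b + 2) = (1 - fps_X) ^ (a + b - 2 * i) * (1 - fps_X) ^ (2 * i + 2)"
        unfolding power_add[symmetric] using ij True by (intro arg_cong[of _ _ "power _"]) auto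
      have e2: "?z ^ (a - i) * ?z ^ (b - j) = ?z ^ (a + b - 2 * i)"
        unfolding power_add[symmetric] using ij True by (intro arg_cong[of _ _ "power _"]) auto
      have ac: "(x * y) * (c * d * z * P) = c * d * (x * z) * (y * P)" for x y z c d P :: "real fps"
        by (simp only: mult_ac)
      have "(1 - fps_X) ^ (a + b + 2) * (?c i j * ?P) =
        of_nat (a choose i) * of_nat (b choose j) * ((1 - fps_X) ^ (a + b - 2 * i) * ?z ^ (a + b - 2 * i)) *
        ((1 - fps_X) ^ (2 * i + 2) * ?P)"
        unfolding e1 e2 by (rule ac)
      also have "\<dots> = of_nat (a choose i) * of_nat (b choose j) * ((1 + fps_X) ^ (a + b - 2 * i)) *
        (of_nat ((2 * i) choose i) * fps_X ^ i)"
        unfolding power_mult_distrib[symmetric] z meixner2_inner using True by simp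
      finally show ?thesis
        using True by (simp add: mult_ac)
    qed
  qed
  also have "\<dots> = (\<Sum>i\<le>a. if i \<le> b then of_nat (((2 * i) choose i) * (a choose i) * (b choose i)) * fps_X ^ i * (1 + fps_X) ^ (a + b - 2 * i) else 0)"
    by (simp add: sum.delta del: of_nat_mult)
  also have "\<dots> = (\<Sum>i\<in>{..a} \<inter> {i. i \<le> b}. of_nat (((2 * i) choose i) * (a choose i) * (b choose i)) * fps_X ^ i * (1 + fps_X) ^ (a + b - 2 * i))"
    by (simp add: sum.inter_restrict del: of_nat_mult cong: if_cong)
  also have "{..a} \<inter> {i. i \<le> b} = {..min a b}"
    by auto
  finally show ?thesis .
qed

text \<open>This is (1 + t)^(a + b + 1) \<gamma>(t / (1 + t)^2) with denominators cleared; since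
  \<open>2 * i \<le> a + b\<close> in the sum, the exponent is at least 1 and the subtraction is
  never truncated.\<close>

definition bip_h :: "nat \<Rightarrow> nat \<Rightarrow> real poly" where
  "bip_h a b = (\<Sum>i\<le>min a b. smult (real (((2 * i) choose i) * (a choose i) * (b choose i)))
     (monom 1 i * [:1, 1:] ^ (a + b + 1 - 2 * i)))"

lemma fps_of_poly_bip_h:
  "fps_of_poly (bip_h a b) = (1 - fps_X) ^ (a + b + 2) *
     ((1 + fps_X) * fps_psum2 (\<lambda>p q. of_nat (slice_count a p q) * of_nat (slice_count b p q)))"
proof -
  have "fps_of_poly (bip_h a b) = (1 + fps_X) *
     (\<Sum>i\<le>min a b. of_nat (((2 * i) choose i) * (a choose i) * (b choose i)) * fps_X ^ i * (1 + fps_X) ^ (a + b - 2 * i))"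
    unfolding bip_h_def fps_of_poly_sum sum_distrib_left
  proof (intro sum.cong refl)
    fix i assume "i \<in> {..min a b}"
    hence "a + b + 1 - 2 * i = Suc (a + b - 2 * i)"
      by auto
    thus "fps_of_poly (smult (real (((2 * i) choose i) * (a choose i) * (b choose i))) (monom 1 i * [:1, 1:] ^ (a + b + 1 - 2 * i))) =
      (1 + fps_X) * (of_nat (((2 * i) choose i) * (a choose i) * (b choose i)) * fps_X ^ i * (1 + fps_X) ^ (a + b - 2 * i))"
      by (simp add: fps_of_poly_smult fps_of_poly_mult fps_of_poly_power fps_of_poly_monom' fps_of_poly_pCons
            fps_of_nat[symmetric] mult_ac)
  qed
  also have "\<dots> = (1 - fps_X) ^ (a + b + 2) *
     ((1 + fps_X) * fps_psum2 (\<lambda>p q. of_nat (slice_count a p q) * of_nat (slice_count b p q)))"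
    by (subst slice_count_psum2[symmetric]) (simp only: mult_ac)
  finally show ?thesis .
qed

lemma fps_psum2_const: "fps_psum2 (\<lambda>p q. fps_const (c p q)) = Abs_fps (\<lambda>n. \<Sum>p\<le>n. c p (n - p))"
proof (rule fps_ext)
  fix n
  have "(\<Sum>q\<le>m. if m - q = 0 then c p q else 0) = c p m" for p m
  proof -
    have "(\<Sum>q\<le>m. if m - q = 0 then c p q else 0) = (\<Sum>q\<le>m. if q = m then c p q else 0)"
      by (rule sum.cong) auto
    thus ?thesis by simp
  qed
  thus "fps_nth (fps_psum2 (\<lambda>p q. fps_const (c p q))) n = fps_nth (Abs_fps (\<lambda>n. \<Sum>p\<le>n. c p (n - p))) n"
    by (simp add: fps_psum2_def fps_psum_def)
qed

lemma h_star_bipartite_eq: "h_star_bipartite a b = bip_h a b"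
proof -
  let ?S = "ehrhart_series (bipartite_vertices (a + 1) (b + 1)) (bip_polytope (a + 1) (b + 1))"
  have "?S = (1 + fps_X) * fps_psum2 (\<lambda>p q. of_nat (slice_count a p q) * of_nat (slice_count b p q))"
  proof -
    have "of_nat (slice_count a p q) * of_nat (slice_count b p q) =
        fps_const (real (slice_count a p q) * real (slice_count b p q))" for p q
      by (metis fps_const_mult fps_of_nat)
    thus ?thesis
      using ehrhart_series_bipartite[of a b] by (simp only: fps_psum2_const Suc_eq_plus1)
  qed
  hence S: "fps_of_poly (bip_h a b) = (1 - fps_X) ^ (a + b + 1 + 1) * ?S"
    by (simp add: fps_of_poly_bip_h)
  have u: "fps_nth ((1 - fps_X :: real fps) ^ (a + b + 1 + 1)) 0 \<noteq> 0"
    by (simp add: fps_nth_power_0)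
  \<comment> \<open>A power of 1 - t is a unit among power series, so the defining equation has
    exactly one solution and the \<open>THE\<close> in \<open>h_star\<close> evaluates to
    it.\<close>
  have iff: "?S = fps_of_poly h / (1 - fps_X) ^ (a + b + 1 + 1) \<longleftrightarrow> h = bip_h a b" for h
  proof
    assume "?S = fps_of_poly h / (1 - fps_X) ^ (a + b + 1 + 1)"
    hence "fps_of_poly (bip_h a b) = fps_of_poly h"
      using S u by (simp add: fps_divide_unit inverse_mult_eq_1' mult.left_commute)
    thus "h = bip_h a b"
      by simp
  next
    assume "h = bip_h a b"
    thus "?S = fps_of_poly h / (1 - fps_X) ^ (a + b + 1 + 1)"
      using S u by (simp add: fps_divide_unit inverse_mult_eq_1' mult_ac)
  qed
  show ?thesis
    unfolding h_star_bipartite_def h_star_def iff by simp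
qed

subsection \<open>Real-rootedness of the gamma polynomial\<close>

abbreviation cpoly :: "real poly \<Rightarrow> complex poly" where
  "cpoly \<equiv> map_poly of_real"

lemma cpoly_pCons: "cpoly (pCons a p) = pCons (of_real a) (cpoly p)"
  by (cases "p = 0 \<and> a = 0") (auto simp: map_poly_pCons)

lemma cpoly_add: "cpoly (p + q) = cpoly p + cpoly q"
  by (rule poly_eqI) (simp add: coeff_map_poly)

lemma cpoly_smult: "cpoly (smult c p) = smult (of_real c) (cpoly p)"
  by (rule poly_eqI) (simp add: coeff_map_poly)

lemma cpoly_sum: "cpoly (\<Sum>i\<in>A. f i) = (\<Sum>i\<in>A. cpoly (f i))"
  by (rule poly_eqI) (simp add: coeff_map_poly coeff_sum)

lemma cpoly_mult: "cpoly (p * q) = cpoly p * cpoly q"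
  by (rule poly_eqI) (simp add: coeff_map_poly coeff_mult)

lemma cpoly_pderiv: "cpoly (pderiv p) = pderiv (cpoly p)"
  by (rule poly_eqI) (simp add: coeff_map_poly coeff_pderiv)

lemma cpoly_monom: "cpoly (monom c n) = monom (of_real c) n"
  by (rule poly_eqI) (simp add: coeff_map_poly)

lemma poly_cpoly_of_real: "poly (cpoly p) (of_real x) = of_real (poly p x)"
  by (induction p) (simp_all add: cpoly_pCons)

lemma real_rooted_nonzero: "real_rooted p \<Longrightarrow> p \<noteq> 0"
  by (auto simp: real_rooted_def complex_is_Real_iff dest: spec[of _ \<i>])

section \<open>Factorization of real-rooted polynomials\<close>

definition root_prod :: "real list \<Rightarrow> real poly" where
  "root_prod rs = (\<Prod>r\<leftarrow>rs. [:- r, 1:])"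

lemma root_prod_simps [simp]:
  "root_prod [] = 1" "root_prod (r # rs) = [:- r, 1:] * root_prod rs"
  "root_prod (rs @ rs') = root_prod rs * root_prod rs'"
  by (simp_all add: root_prod_def)

lemma root_prod_nonzero [simp]: "root_prod rs \<noteq> 0"
  by (induction rs) (auto simp del: mult_pCons_left)

lemma degree_root_prod: "degree (root_prod rs) = length rs"
  by (induction rs) (auto simp: degree_mult_eq simp del: mult_pCons_left)

lemma proots_root_prod: "proots (root_prod rs) = mset rs"
  by (induction rs) (auto simp: proots_mult simp del: mult_pCons_left)

lemma poly_cpoly_root_prod: "poly (cpoly (root_prod rs)) z = (\<Prod>r\<leftarrow>rs. z - of_real r)"
  by (induction rs) (auto simp: cpoly_mult cpoly_pCons simp del: mult_pCons_left)

lemma real_rooted_root_prod: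
  assumes "c \<noteq> 0"
  shows "real_rooted (smult c (root_prod rs))"
  using assms by (auto simp: real_rooted_def cpoly_smult poly_cpoly_root_prod prod_list_zero_iff)

lemma real_rooted_split:
  assumes "real_rooted p"
  shows "\<exists>rs. p = smult (lead_coeff p) (root_prod rs)"
  using assms
proof (induction "degree p" arbitrary: p)
  case 0
  then obtain c where "p = [:c:]"
    by (metis degree_eq_zeroE)
  thus ?case
    by (intro exI[of _ "[]"]) simp
next
  case (Suc n)
  have "degree (cpoly p) = Suc n"
    using Suc.hyps(2) by (simp add: degree_map_poly)
  hence "\<not> constant (poly (cpoly p))"
    by (simp add: constant_degree)
  then obtain z where z: "poly (cpoly p) z = 0"
    using fundamental_theorem_of_algebra by blast
  then obtain r where "z = of_real r"
    using Suc.prems by (auto simp: real_rooted_def elim: Reals_cases)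
  with z have "poly p r = 0"
    by (simp add: poly_cpoly_of_real)
  then obtain q where q: "p = [:- r, 1:] * q"
    by (metis dvdE poly_eq_0_iff_dvd)
  have p0: "p \<noteq> 0"
    using Suc.prems by (rule real_rooted_nonzero)
  hence "degree p = Suc (degree q)"
    using q by (auto simp: degree_mult_eq simp del: mult_pCons_left)
  moreover have "real_rooted q"
    using Suc.prems unfolding real_rooted_def q cpoly_mult poly_mult by auto
  ultimately obtain rs where rs: "q = smult (lead_coeff q) (root_prod rs)"
    using Suc by auto
  have "lead_coeff p = lead_coeff q"
    unfolding q lead_coeff_mult by simp
  moreover have "p = smult (lead_coeff q) (root_prod (r # rs))"
    by (subst q, subst rs) (simp only: root_prod_simps mult_smult_right)
  ultimately show ?case
    by metis
qed

lemma Im_sum_inverse_diff_neg: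
  assumes "Im z > 0" "rs \<noteq> []"
  shows "Im (\<Sum>r\<leftarrow>rs. 1 / (z - of_real r)) < 0"
proof -
  have neg: "Im (1 / (z - of_real r)) < 0" for r
    using assms(1) by (simp add: Im_divide divide_less_0_iff sum_power2_gt_zero_iff)
  have le: "Im (\<Sum>r\<leftarrow>rs. 1 / (z - of_real r)) \<le> 0" for rs
  proof (induction rs)
    case (Cons r rs)
    thus ?case using neg[of r] by simp
  qed simp
  show ?thesis
    using assms(2) neg[of "hd rs"] le[of "tl rs"] by (cases rs) auto
qed

lemma poly_pderiv_root_prod:
  assumes "z \<notin> \<real>"
  shows "poly (pderiv (cpoly (root_prod rs))) z = poly (cpoly (root_prod rs)) z * (\<Sum>r\<leftarrow>rs. 1 / (z - of_real r))"
proof (induction rs)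
  case Nil
  show ?case
    by (simp add: map_poly_1)
next
  case (Cons r rs)
  have "z - of_real r \<noteq> 0"
    using assms by auto
  have d: "poly (pderiv (cpoly (root_prod (r # rs)))) z =
      poly (cpoly (root_prod rs)) z + (z - of_real r) * poly (pderiv (cpoly (root_prod rs))) z"
    unfolding root_prod_simps cpoly_mult pderiv_mult by (simp add: cpoly_pCons pderiv_pCons algebra_simps)
  have e: "poly (cpoly (root_prod (r # rs))) z = (z - of_real r) * poly (cpoly (root_prod rs)) z"
    unfolding root_prod_simps cpoly_mult by (simp add: cpoly_pCons algebra_simps)
  have alg: "A + w * (A * S) = w * A * (1 / w + S)" if "w \<noteq> 0" for A S w :: complex
    using that by (simp add: field_simps)
  show ?case
    unfolding d e Cons list.map sum_list.Cons by (rule alg) fact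
qed

text \<open>In the upper half plane every \<open>1 / (z - r)\<close> has negative imaginary part, so \<open>f' / f\<close> cannot be real there.\<close>

lemma real_rooted_add_pderiv:
  assumes "real_rooted f" "s > 0"
  shows "real_rooted (f + smult s (pderiv f))"
proof -
  obtain rs where rs: "f = smult (lead_coeff f) (root_prod rs)"
    using real_rooted_split[OF assms(1)] by blast
  define c where "c = lead_coeff f"
  have c: "c \<noteq> 0" "f = smult c (root_prod rs)"
    using real_rooted_nonzero[OF assms(1)] rs by (auto simp: c_def)
  have up: "poly (cpoly (f + smult s (pderiv f))) z \<noteq> 0" if z: "Im z > 0" for z
  proof -
    let ?S = "\<Sum>r\<leftarrow>rs. 1 / (z - of_real r)"
    have zR: "z \<notin> \<real>"
      using z by (auto simp: complex_is_Real_iff)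
    have "poly (cpoly (f + smult s (pderiv f))) z = of_real c * poly (cpoly (root_prod rs)) z * (1 + of_real s * ?S)"
      unfolding cpoly_add cpoly_smult cpoly_pderiv c(2) poly_add poly_smult pderiv_smult poly_pderiv_root_prod[OF zR]
      by (simp add: algebra_simps)
    moreover have "poly (cpoly (root_prod rs)) z \<noteq> 0"
      using zR by (auto simp: poly_cpoly_root_prod prod_list_zero_iff)
    moreover have "1 + of_real s * ?S \<noteq> 0"
    proof (cases "rs = []")
      case False
      have "Im (1 + of_real s * ?S) < Im 0"
        using Im_sum_inverse_diff_neg[OF z False] assms(2) by (simp add: mult_pos_neg)
      thus ?thesis
        by (metis less_irrefl)
    qed simp
    ultimately show ?thesis
      using c by simp
  qed
  \<comment> \<open>The coefficients are real, so conjugation reduces the lower half plane to the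
    upper one.\<close>
  have cnj: "poly (cpoly p) (cnj z) = cnj (poly (cpoly p) z)" for p z
    by (induction p) (simp_all add: cpoly_pCons)
  show ?thesis
    unfolding real_rooted_def
  proof (intro allI impI)
    fix z assume z: "poly (cpoly (f + smult s (pderiv f))) z = 0"
    show "z \<in> \<real>"
      using up[of z] up[of "cnj z"] z cnj[of "f + smult s (pderiv f)" z]
      by (cases "Im z" "0::real" rule: linorder_cases) (auto simp: complex_is_Real_iff)
  qed
qed

text \<open>Each factor satisfies \<open>\<bar>Im z\<bar> \<le> norm (z - r)\<close>. The bound
  depends on \<open>z\<close> and the degree alone, so limits of monic real-rooted polynomials of
  fixed degree again have no nonreal zeros.\<close>

lemma real_rooted_monic_lower_bound:
  assumes "real_rooted f" "lead_coeff f = 1"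
  shows "\<bar>Im z\<bar> ^ degree f \<le> norm (poly (cpoly f) z)"
proof -
  obtain rs where rs: "f = root_prod rs"
    using real_rooted_split[OF assms(1)] assms(2) by auto
  have "\<bar>Im z\<bar> ^ length rs \<le> norm (\<Prod>r\<leftarrow>rs. z - of_real r)"
  proof (induction rs)
    case (Cons r rs)
    have "\<bar>Im z\<bar> \<le> norm (z - of_real r)"
      using abs_Im_le_cmod[of "z - of_real r"] by simp
    with Cons show ?case
      by (simp add: norm_mult mult_mono)
  qed simp
  thus ?thesis
    by (simp add: rs poly_cpoly_root_prod degree_root_prod)
qed

section \<open>Products of factors 1 + s x and differential operators\<close>

definition pos_prod :: "real poly \<Rightarrow> bool" where
  "pos_prod p \<longleftrightarrow> (\<exists>ss. (\<forall>s\<in>set ss. s > 0) \<and> p = (\<Prod>s\<leftarrow>ss. [:1, s:]))"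

lemma pos_prod_mult: "pos_prod p \<Longrightarrow> pos_prod q \<Longrightarrow> pos_prod (p * q)"
  unfolding pos_prod_def
proof (elim exE conjE)
  fix ss ss' :: "real list"
  assume "\<forall>s\<in>set ss. s > 0" "p = (\<Prod>s\<leftarrow>ss. [:1, s:])" "\<forall>s\<in>set ss'. s > 0" "q = (\<Prod>s\<leftarrow>ss'. [:1, s:])"
  thus "\<exists>ss. (\<forall>s\<in>set ss. 0 < s) \<and> p * q = (\<Prod>s\<leftarrow>ss. [:1, s:])"
    by (intro exI[of _ "ss @ ss'"]) auto
qed

lemma pos_prod_coeff:
  assumes "pos_prod p"
  shows "coeff p i \<ge> 0" "coeff p 0 = 1"
proof -
  obtain ss where ss: "\<forall>s\<in>set ss. s > 0" "p = (\<Prod>s\<leftarrow>ss. [:1, s:])"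
    using assms by (auto simp: pos_prod_def)
  have "(\<forall>i. coeff p i \<ge> 0) \<and> coeff p 0 = 1"
    unfolding ss(2) using ss(1)
  proof (induction ss)
    case (Cons s ss)
    thus ?case by (auto simp: coeff_pCons split: nat.splits)
  qed (simp add: coeff_1)
  thus "coeff p i \<ge> 0" "coeff p 0 = 1"
    by auto
qed

text \<open>Nonnegative coefficients with constant term 1 make the polynomial positive on [0,
  \<infinity>), so every root r is negative and x - r is - r times 1 + s x with s = - 1 / r. The
  constant term then fixes the scalar as 1.\<close>

lemma pos_prodI:
  assumes "real_rooted p" "\<And>i. coeff p i \<ge> 0" "coeff p 0 = 1"
  shows "pos_prod p"
proof -
  obtain rs where rs: "p = smult (lead_coeff p) (root_prod rs)"
    using real_rooted_split[OF assms(1)] by blast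
  have neg: "r < 0" if "r \<in> set rs" for r
  proof (rule ccontr)
    assume "\<not> r < 0"
    have "1 = (\<Sum>i\<le>0. coeff p i * r ^ i)"
      using assms(3) by simp
    also have "\<dots> \<le> (\<Sum>i\<le>degree p. coeff p i * r ^ i)"
      using \<open>\<not> r < 0\<close> assms(2) by (intro sum_mono2) auto
    also have "\<dots> = poly p r"
      by (simp add: poly_altdef)
    also have "poly p r = 0"
    proof -
      have "poly (root_prod rs) r = 0"
        using that by (induction rs) auto
      thus ?thesis
        by (subst rs) simp
    qed
    finally show False by simp
  qed
  have "root_prod rs = smult (\<Prod>r\<leftarrow>rs. - r) (\<Prod>s\<leftarrow>map (\<lambda>r. - inverse r) rs. [:1, s:])"
    using neg
  proof (induction rs)
    case (Cons r rs)
    have "[:- r, 1:] = smult (- r) [:1, - inverse r:]"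
      using Cons.prems[of r] by simp
    thus ?case
      using Cons by (simp del: mult_pCons_left smult_pCons add: mult_ac)
  qed simp
  with rs obtain c where c: "p = smult c (\<Prod>s\<leftarrow>map (\<lambda>r. - inverse r) rs. [:1, s:])"
    by (metis smult_smult)
  let ?q = "\<Prod>s\<leftarrow>map (\<lambda>r. - inverse r) rs. [:1, s:]"
  have q: "pos_prod ?q"
    unfolding pos_prod_def using neg by (intro exI[of _ "map (\<lambda>r. - inverse r) rs"]) auto
  have "c = 1"
    using assms(3) pos_prod_coeff(2)[OF q] by (subst (asm) c) simp
  thus ?thesis
    using c q by simp
qed

text \<open>\<open>diff_op p n\<close> is \<open>p(D) x\<^sup>n\<close> with \<open>D = d/dx\<close>, and \<open>fall_op p n\<close> is its reversal.\<close>

definition diff_op :: "real poly \<Rightarrow> nat \<Rightarrow> real poly" where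
  "diff_op p n = (\<Sum>i\<le>n. monom (coeff p i * (real (n choose i) * fact i)) (n - i))"

definition fall_op :: "real poly \<Rightarrow> nat \<Rightarrow> real poly" where
  "fall_op p n = (\<Sum>i\<le>n. monom (coeff p i * (real (n choose i) * fact i)) i)"

lemma coeff_diff_op:
  "coeff (diff_op p n) j = (if j \<le> n then coeff p (n - j) * (real (n choose j) * fact (n - j)) else 0)"
proof -
  have "coeff (diff_op p n) j = (\<Sum>i\<le>n. if n - i = j then coeff p i * (real (n choose i) * fact i) else 0)"
    by (simp add: diff_op_def coeff_sum)
  also have "\<dots> = (\<Sum>i\<le>n. if i = n - j \<and> j \<le> n then coeff p i * (real (n choose i) * fact i) else 0)"
    by (rule sum.cong) auto
  finally show ?thesis
    by (auto simp: binomial_symmetric[symmetric])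
qed

lemma coeff_fall_op: "coeff (fall_op p n) i = coeff p i * (real (n choose i) * fact i)"
  by (auto simp: fall_op_def coeff_sum binomial_eq_0)

text \<open>A factor 1 + s x of the symbol acts as 1 + s D. On coefficients this is the absorption
  identity (j + 1) C(n, j + 1) = (n - j) C(n, j).\<close>

lemma diff_op_step: "diff_op ([:1, s:] * p) n = diff_op p n + smult s (pderiv (diff_op p n))"
proof (rule poly_eqI)
  fix j
  show "coeff (diff_op ([:1, s:] * p) n) j = coeff (diff_op p n + smult s (pderiv (diff_op p n))) j"
  proof (cases "j < n")
    case True
    then obtain k where k: "n - j = Suc k" "n = Suc (j + k)"
      by (metis Suc_diff_Suc add_diff_inverse_nat add_Suc_right diff_Suc_1 less_imp_le_nat not_less)
    have "Suc j * (n choose Suc j) = (n choose j) * Suc k"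
      using k by (metis binomial_absorb_comp binomial_absorption diff_Suc_1 mult.commute)
    hence "(1 + real j) * real (n choose Suc j) = real (n choose j) * (1 + real k)"
      by (metis of_nat_Suc of_nat_mult)
    thus ?thesis
      using k by (simp add: coeff_diff_op coeff_pderiv algebra_simps del: binomial_Suc_Suc)
  next
    case False
    thus ?thesis
      by (auto simp: coeff_diff_op coeff_pderiv)
  qed
qed

lemma diff_op_1: "diff_op 1 n = monom 1 n"
  by (rule poly_eqI) (auto simp: coeff_diff_op coeff_1)

lemma diff_op_monic:
  assumes "coeff p 0 = 1"
  shows "degree (diff_op p n) = n" "lead_coeff (diff_op p n) = 1"
proof -
  show "degree (diff_op p n) = n"
    by (rule antisym; (rule degree_le | rule le_degree)) (auto simp: coeff_diff_op assms)
  thus "lead_coeff (diff_op p n) = 1"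
    by (simp add: coeff_diff_op assms)
qed

lemma real_rooted_diff_op:
  assumes "pos_prod p"
  shows "real_rooted (diff_op p n)"
proof -
  obtain ss where ss: "\<forall>s\<in>set ss. s > 0" "p = (\<Prod>s\<leftarrow>ss. [:1, s:])"
    using assms by (auto simp: pos_prod_def)
  show ?thesis
    unfolding ss(2) using ss(1)
  proof (induction ss)
    case Nil
    show ?case
      by (auto simp: diff_op_1 real_rooted_def cpoly_monom poly_monom)
  next
    case (Cons s ss)
    thus ?case
      by (simp add: diff_op_step real_rooted_add_pderiv del: mult_pCons_left)
  qed
qed

lemma poly_fall_op:
  assumes "z \<noteq> 0"
  shows "poly (cpoly (fall_op p n)) z = z ^ n * poly (cpoly (diff_op p n)) (inverse z)"
  unfolding fall_op_def diff_op_def cpoly_sum poly_sum sum_distrib_left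
proof (rule sum.cong[OF refl])
  fix i assume i: "i \<in> {..n}"
  hence "z ^ n = z ^ i * z ^ (n - i)"
    by (simp add: power_add[symmetric])
  thus "poly (cpoly (monom (coeff p i * (real (n choose i) * fact i)) i)) z =
    z ^ n * poly (cpoly (monom (coeff p i * (real (n choose i) * fact i)) (n - i))) (inverse z)"
    using assms by (simp add: cpoly_monom poly_monom power_inverse)
qed

text \<open>Reversal sends a nonzero root z to 1 / z and thus keeps roots real. The premise concerns
  \<open>diff_op p n\<close> and not \<open>p\<close>, because in \<open>pos_prod_bessel\<close>
  real-rootedness is available only after applying the operator.\<close>

lemma pos_prod_fall_opI:
  assumes "real_rooted (diff_op p n)" "\<And>i. coeff p i \<ge> 0" "coeff p 0 = 1"
  shows "pos_prod (fall_op p n)"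
proof (rule pos_prodI)
  show "real_rooted (fall_op p n)"
    unfolding real_rooted_def
  proof (intro allI impI)
    fix z assume z: "poly (cpoly (fall_op p n)) z = 0"
    show "z \<in> \<real>"
    proof (cases "z = 0")
      case False
      hence "poly (cpoly (diff_op p n)) (inverse z) = 0"
        using z by (simp add: poly_fall_op)
      hence "inverse z \<in> \<real>"
        using assms(1) by (auto simp: real_rooted_def)
      thus ?thesis
        by (metis Reals_inverse inverse_inverse_eq)
    qed simp
  qed
qed (simp_all add: coeff_fall_op assms)

lemma pos_prod_fall_op: "pos_prod p \<Longrightarrow> pos_prod (fall_op p n)"
  by (rule pos_prod_fall_opI) (simp_all add: real_rooted_diff_op pos_prod_coeff)

text \<open>The Laguerre polynomial L_N evaluated at - x / N; the scaling makes the coefficients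
  converge as N grows.\<close>

definition laguerre :: "nat \<Rightarrow> real poly" where
  "laguerre N = (\<Sum>i\<le>N. monom (real (N choose i) / (fact i * real N ^ i)) i)"

lemma coeff_laguerre: "coeff (laguerre N) i = real (N choose i) / (fact i * real N ^ i)"
  by (auto simp: laguerre_def coeff_sum binomial_eq_0)

text \<open>Applying (1 + D)^N to x^N gives N! L_N(- x), which is real-rooted by
  \<open>real_rooted_diff_op\<close>; substituting x / N keeps its roots real.\<close>

lemma pos_prod_laguerre:
  assumes "N > 0"
  shows "pos_prod (laguerre N)"
proof (rule pos_prodI)
  let ?p = "[:1, 1:] ^ N :: real poly"
  have "pos_prod ?p"
    unfolding pos_prod_def by (intro exI[of _ "replicate N 1"]) auto
  hence rr: "real_rooted (diff_op ?p N)"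
    by (rule real_rooted_diff_op)
  have p: "coeff ?p i = real (N choose i)" for i
    by (cases "i \<le> N") (auto simp: coeff_linear_poly_power binomial_eq_0 coeff_eq_0 degree_linear_power)
  have c: "coeff (diff_op ?p N) i / real N ^ i = fact N * coeff (laguerre N) i" for i
  proof (cases "i \<le> N")
    case True
    have "fact (N - i) * real (N choose i) = fact N / fact i"
      using binomial_fact[OF True, where 'a = real] by (simp add: field_simps)
    moreover have "coeff (diff_op ?p N) i = fact (N - i) * real (N choose i) * real (N choose i)"
      using True by (simp add: coeff_diff_op p binomial_symmetric[symmetric])
    ultimately have "coeff (diff_op ?p N) i = fact N / fact i * real (N choose i)"
      by simp
    thus ?thesis
      by (simp add: coeff_laguerre)
  qed (simp add: coeff_diff_op coeff_laguerre binomial_eq_0)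
  have ev: "poly (cpoly (diff_op ?p N)) (z / of_nat N) = fact N * poly (cpoly (laguerre N)) z" for z
  proof -
    have "poly (cpoly q) w = (\<Sum>i\<le>N. of_real (coeff q i) * w ^ i)" if "\<And>i. i > N \<Longrightarrow> coeff q i = 0" for q w
    proof -
      have "degree q \<le> N"
        by (rule degree_le) (simp add: that)
      hence "poly (cpoly q) w = poly (cpoly (\<Sum>i\<le>N. monom (coeff q i) i)) w"
        by (simp only: poly_as_sum_of_monoms')
      thus ?thesis
        by (simp add: cpoly_sum poly_sum cpoly_monom poly_monom)
    qed
    note ev = this
    have "of_real (coeff (diff_op ?p N) i) * (z / of_nat N) ^ i = fact N * (of_real (coeff (laguerre N) i) * z ^ i)" for i
    proof -
      have "of_real (coeff (diff_op ?p N) i) * (z / of_nat N) ^ i = of_real (coeff (diff_op ?p N) i / real N ^ i) * z ^ i"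
        by (simp add: power_divide)
      thus ?thesis
        unfolding c by simp
    qed
    note eq = this
    have e1: "poly (cpoly (diff_op ?p N)) (z / of_nat N) = (\<Sum>i\<le>N. of_real (coeff (diff_op ?p N) i) * (z / of_nat N) ^ i)"
      by (rule ev) (simp add: coeff_diff_op)
    have e2: "poly (cpoly (laguerre N)) z = (\<Sum>i\<le>N. of_real (coeff (laguerre N) i) * z ^ i)"
      by (rule ev) (simp add: coeff_laguerre binomial_eq_0)
    show ?thesis
      unfolding e1 e2 sum_distrib_left by (intro sum.cong refl eq)
  qed
  show "real_rooted (laguerre N)"
    unfolding real_rooted_def
  proof (intro allI impI)
    fix z assume "poly (cpoly (laguerre N)) z = 0"
    hence "poly (cpoly (diff_op ?p N)) (z / of_nat N) = 0"
      by (simp add: ev)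
    hence "z / of_nat N \<in> \<real>"
      using rr by (auto simp: real_rooted_def)
    hence "z / of_nat N * of_nat N \<in> \<real>"
      by (intro Reals_mult) auto
    thus "z \<in> \<real>"
      using assms by simp
  qed
qed (simp_all add: coeff_laguerre)

lemma coeff_laguerre_tendsto: "(\<lambda>N. coeff (laguerre N) i) \<longlonglongrightarrow> 1 / fact i ^ 2"
proof -
  have "(\<lambda>N. real (N choose i) / real N ^ i) \<longlonglongrightarrow> 1 / fact i"
  proof (induction i)
    case 0
    show ?case by simp
  next
    case (Suc i)
    have "(\<lambda>N. (real N - real i) / real N) \<longlonglongrightarrow> 1"
    proof (rule Lim_transform_eventually)
      show "(\<lambda>N. 1 - real i / real N) \<longlonglongrightarrow> 1"
        using tendsto_diff[OF tendsto_const lim_const_over_n[of "real i"], of 1] by simp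
      show "\<forall>\<^sub>F N in sequentially. 1 - real i / real N = (real N - real i) / real N"
        using eventually_gt_at_top[of 0] by eventually_elim (simp add: field_simps)
    qed
    hence "(\<lambda>N. real (N choose i) / real N ^ i * ((real N - real i) / real N) / real (Suc i)) \<longlonglongrightarrow> 1 / fact i * 1 / real (Suc i)"
      by (intro tendsto_intros Suc) auto
    moreover have "real (N choose Suc i) / real N ^ Suc i =
       real (N choose i) / real N ^ i * ((real N - real i) / real N) / real (Suc i)" for N
    proof -
      have "real (Suc i) * real (N choose Suc i) = (real N - real i) * real (N choose i)"
      proof (cases "i \<le> N")
        case True
        have "Suc i * (N choose Suc i) = (N - i) * (N choose i)"
          using binomial_absorb_comp[of N i] binomial_absorption[of i N] by (simp add: mult.commute)
        thus ?thesis
          using True by (metis of_nat_diff of_nat_mult)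
      qed (simp add: binomial_eq_0)
      thus ?thesis
        by (cases "N = 0") (simp_all add: field_simps del: of_nat_Suc)
    qed
    ultimately show ?case
      by (simp add: mult.commute)
  qed
  from tendsto_divide[OF this tendsto_const[of "fact i"]] show ?thesis
    by (simp add: coeff_laguerre power2_eq_square mult.commute)
qed

text \<open>The limit is the convolution of 1 / i!^2 with itself. Multiplying by k!^2 turns it into
  the sum of the squares of C(k, i), which is C(2k, k).\<close>

lemma coeff_laguerre_square_tendsto:
  "(\<lambda>N. coeff (laguerre N * laguerre N) k) \<longlonglongrightarrow> real ((2 * k) choose k) / fact k ^ 2"
proof -
  have "(\<lambda>N. coeff (laguerre N * laguerre N) k) \<longlonglongrightarrow> (\<Sum>i\<le>k. (1 / fact i ^ 2) * (1 / fact (k - i) ^ 2))"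
    unfolding coeff_mult by (intro tendsto_intros coeff_laguerre_tendsto)
  also have "(\<Sum>i\<le>k. (1 / fact i ^ 2) * (1 / fact (k - i) ^ 2)) = (\<Sum>i\<le>k. real ((k choose i) ^ 2) / fact k ^ 2)"
    by (intro sum.cong refl) (simp add: binomial_fact[where 'a = real] power_divide power_mult_distrib)
  also have "\<dots> = real ((2 * k) choose k) / fact k ^ 2"
    by (simp only: choose_square_sum[symmetric] of_nat_sum sum_divide_distrib)
  finally show ?thesis .
qed

text \<open>The limit of the Laguerre squares is the square of a Bessel function; only the image under
  \<open>diff_op\<close>, which has bounded degree, is needed.\<close>

lemma pos_prod_bessel:
  assumes p: "\<And>i. coeff p i = (if i \<le> n then real ((2 * i) choose i) / fact i ^ 2 else 0)"
  shows "pos_prod (fall_op p n)"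
proof (rule pos_prod_fall_opI)
  show "real_rooted (diff_op p n)"
    unfolding real_rooted_def
  proof (intro allI impI, rule ccontr)
    fix z assume z: "poly (cpoly (diff_op p n)) z = 0" "z \<notin> \<real>"
    let ?q = "\<lambda>N. laguerre N * laguerre N"
    have "(\<lambda>N. poly (cpoly (diff_op (?q N) n)) z) \<longlonglongrightarrow> poly (cpoly (diff_op p n)) z"
      unfolding diff_op_def cpoly_sum poly_sum cpoly_monom poly_monom
      by (intro tendsto_intros) (auto simp: p intro!: coeff_laguerre_square_tendsto)
    hence "(\<lambda>N. norm (poly (cpoly (diff_op (?q N) n)) z)) \<longlonglongrightarrow> 0"
      using z(1) tendsto_norm_zero by fastforce
    \<comment> \<open>The operator images are monic of degree \<open>n\<close> for every N > 0, so
      their lower bound off the real axis is independent of N and survives the limit.\<close>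
    moreover have "\<forall>\<^sub>F N in sequentially. \<bar>Im z\<bar> ^ n \<le> norm (poly (cpoly (diff_op (?q N) n)) z)"
      using eventually_gt_at_top[of 0]
    proof eventually_elim
      case (elim N)
      have q: "pos_prod (?q N)"
        using elim by (intro pos_prod_mult pos_prod_laguerre)
      show ?case
        using real_rooted_monic_lower_bound[OF real_rooted_diff_op[OF q], of n z]
          diff_op_monic[OF pos_prod_coeff(2)[OF q], of n] by simp
    qed
    ultimately have "\<bar>Im z\<bar> ^ n \<le> 0"
      by (rule tendsto_lowerbound) simp
    moreover have "0 < \<bar>Im z\<bar> ^ n"
      using z(2) by (intro zero_less_power) (simp add: complex_is_Real_iff)
    ultimately show False
      by linarith
  qed
qed (auto simp: p)

definition gamma_poly :: "nat \<Rightarrow> nat \<Rightarrow> real poly" where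
  "gamma_poly a b = (\<Sum>i\<le>min a b. monom (real (((2 * i) choose i) * (a choose i) * (b choose i))) i)"

lemma coeff_gamma_poly: "coeff (gamma_poly a b) i = real (((2 * i) choose i) * (a choose i) * (b choose i))"
  by (auto simp: gamma_poly_def coeff_sum binomial_eq_0)

text \<open>The two applications of \<open>fall_op\<close> multiply the i-th coefficient by C(a, i)
  i! and C(b, i) i!, cancelling the denominator i!^2. Cutting \<open>p\<close> off at
  \<open>a\<close> loses nothing, as C(a, i) = 0 beyond.\<close>

lemma pos_prod_gamma_poly: "pos_prod (gamma_poly a b)"
proof -
  define p where "p = (\<Sum>i\<le>a. monom (real ((2 * i) choose i) / fact i ^ 2) i)"
  have p: "coeff p i = (if i \<le> a then real ((2 * i) choose i) / fact i ^ 2 else 0)" for i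
    by (auto simp: p_def coeff_sum)
  have "gamma_poly a b = fall_op (fall_op p a) b"
    by (rule poly_eqI) (auto simp: coeff_gamma_poly coeff_fall_op p binomial_eq_0 power2_eq_square)
  thus ?thesis
    using pos_prod_bessel[OF p] by (simp add: pos_prod_fall_op)
qed

subsection \<open>Interlacing\<close>

definition count_ge :: "real \<Rightarrow> real multiset \<Rightarrow> nat" where
  "count_ge c M = size (filter_mset (\<lambda>x. c \<le> x) M)"

lemma count_ge_simps [simp]:
  "count_ge c {#} = 0" "count_ge c (add_mset x M) = (if c \<le> x then Suc (count_ge c M) else count_ge c M)"
  "count_ge c (M + N) = count_ge c M + count_ge c N"
  by (auto simp: count_ge_def)

lemma count_ge_mono:
  "list_all2 (\<lambda>a b. a \<ge> b) as bs \<Longrightarrow> count_ge c (mset bs) \<le> count_ge c (mset as)"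
  by (induction rule: list_all2_induct) auto

lemma nth_ge_iff:
  assumes "sorted_wrt (\<ge>) as" "i < length as"
  shows "c \<le> as ! i \<longleftrightarrow> i < count_ge c (mset as)"
  using assms
proof (induction as arbitrary: i)
  case (Cons a as)
  show ?case
  proof (cases "c \<le> a")
    case True
    thus ?thesis
      using Cons by (cases i) auto
  next
    case False
    hence "\<forall>x\<in>set as. \<not> c \<le> x"
      using Cons.prems(1) by auto
    hence "count_ge c (mset as) = 0"
      by (auto simp: count_ge_def filter_mset_eq_mempty_iff)
    moreover have "(a # as) ! i \<le> a"
      using Cons.prems by (cases i) auto
    ultimately show ?thesis
      using False by auto
  qed
qed simp

text \<open>Interlacing restated through thresholds: unlike the comparison of sorted root lists,
  this form is visibly preserved when the same root is added to both multisets.\<close>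

definition count_interlace :: "real multiset \<Rightarrow> real multiset \<Rightarrow> bool" where
  "count_interlace N M \<longleftrightarrow> (\<forall>c. count_ge c N \<le> count_ge c M \<and> count_ge c M \<le> Suc (count_ge c N))"

lemma roots_desc: "mset (roots_desc p) = proots p" "sorted_wrt (\<ge>) (roots_desc p)"
  by (simp_all add: roots_desc_def sorted_wrt_rev)

lemma interlaces_count:
  assumes "real_rooted g" "real_rooted f" "count_interlace (proots g) (proots f)"
  shows "interlaces g f"
proof -
  let ?as = "roots_desc f" and ?bs = "roots_desc g"
  have cnt: "count_ge c (mset ?bs) \<le> count_ge c (mset ?as)" "count_ge c (mset ?as) \<le> Suc (count_ge c (mset ?bs))" for c
    using assms(3) by (auto simp: count_interlace_def roots_desc)
  have "finite (set ?as \<union> set ?bs)"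
    by simp
  \<comment> \<open>A threshold below all roots turns the two counting inequalities into the length
    condition.\<close>
  then obtain c where "\<forall>x\<in>set ?as \<union> set ?bs. c \<le> x"
    by (meson Min_le finite.emptyI bdd_below_finite bdd_below_def)
  hence "count_ge c (mset ?as) = length ?as" "count_ge c (mset ?bs) = length ?bs"
    unfolding count_ge_def by (metis Un_iff filter_mset_True filter_mset_cong set_mset_mset size_mset)+
  hence len: "length ?bs \<le> length ?as" "length ?as \<le> Suc (length ?bs)"
    using cnt[of c] by auto
  have "?as ! i \<ge> ?bs ! i" if "i < length ?bs" for i
  proof -
    have "i < count_ge (?bs ! i) (mset ?bs)"
      using nth_ge_iff[OF roots_desc(2) that] by blast
    hence "i < count_ge (?bs ! i) (mset ?as)"
      using cnt(1) by (rule less_le_trans)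
    thus ?thesis
      using nth_ge_iff[OF roots_desc(2), of i f] that len by simp
  qed
  moreover have "?bs ! i \<ge> ?as ! (i + 1)" if "i + 1 < length ?as" for i
  proof -
    have "i + 1 < count_ge (?as ! (i + 1)) (mset ?as)"
      using nth_ge_iff[OF roots_desc(2) that] by blast
    hence "i < count_ge (?as ! (i + 1)) (mset ?bs)"
      using cnt(2)[of "?as ! (i + 1)"] by linarith
    thus ?thesis
      using nth_ge_iff[OF roots_desc(2), of i g] that len by simp
  qed
  ultimately show ?thesis
    using assms(1,2) len unfolding interlaces_def Let_def by auto
qed

text \<open>A list of pairs \<open>(r, \<lambda>)\<close> encodes \<open>f = \<Prod> (x - r)\<close> together with \<open>g = \<Sum> \<lambda> f / (x - r)\<close>.\<close>

fun residue_poly :: "(real \<times> real) list \<Rightarrow> real poly" where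
  "residue_poly [] = 0"
| "residue_poly ((r, l) # xs) = smult l (root_prod (map fst xs)) + [:- r, 1:] * residue_poly xs"

lemma residue_poly_append:
  "residue_poly (xs @ ys) = residue_poly xs * root_prod (map fst ys) + root_prod (map fst xs) * residue_poly ys"
  by (induction xs rule: residue_poly.induct)
     (auto simp: algebra_simps simp del: mult_pCons_left mult_pCons_right)

lemma residue_poly_move: "residue_poly (xs @ y # ys) = residue_poly (y # xs @ ys)"
  by (cases y) (simp add: residue_poly_append algebra_simps del: mult_pCons_left mult_pCons_right)

lemma root_prod_mset_cong: "mset xs = mset ys \<Longrightarrow> root_prod xs = root_prod ys"
  unfolding root_prod_def by (metis mset_map prod_mset_prod_list)

text \<open>The nodes may thus be reordered freely, as needed to sort them and to bring equal nodes
  together.\<close>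

lemma residue_poly_mset_cong:
  assumes "mset xs = mset ys"
  shows "residue_poly xs = residue_poly ys"
  using assms
proof (induction xs arbitrary: ys)
  case (Cons x xs)
  then obtain as bs where ys: "ys = as @ x # bs"
    by (metis list.set_intros(1) set_mset_mset split_list)
  hence m: "mset xs = mset (as @ bs)"
    using Cons.prems by simp
  obtain r l where x: "x = (r, l)"
    by (cases x)
  have "root_prod (map fst xs) = root_prod (map fst (as @ bs))"
    by (rule root_prod_mset_cong) (metis m mset_map)
  thus ?case
    unfolding ys residue_poly_move x residue_poly.simps using Cons.IH[OF m] by simp
qed simp

lemma degree_residue_poly: "residue_poly xs = 0 \<or> degree (residue_poly xs) < length xs"
proof (induction xs rule: residue_poly.induct)
  case (2 r l xs)
  have "degree (residue_poly ((r, l) # xs)) \<le> length xs"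
    unfolding residue_poly.simps
  proof (rule degree_add_le)
    show "degree (smult l (root_prod (map fst xs))) \<le> length xs"
      using degree_smult_le[of l "root_prod (map fst xs)"] by (simp add: degree_root_prod)
    show "degree ([:- r, 1:] * residue_poly xs) \<le> length xs"
      using 2 by (cases "residue_poly xs = 0") (auto simp: degree_mult_eq simp del: mult_pCons_left)
  qed
  thus ?case
    by auto
qed simp

lemma poly_root_prod: "poly (root_prod rs) x = (\<Prod>r\<leftarrow>rs. x - r)"
  by (induction rs) (auto simp: algebra_simps)

lemma poly_residue_poly_quotient:
  assumes "x \<notin> fst ` set xs"
  shows "poly (residue_poly xs) x = poly (root_prod (map fst xs)) x * (\<Sum>(r, l)\<leftarrow>xs. l / (x - r))"
  using assms
  by (induction xs rule: residue_poly.induct) (auto simp: field_simps)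

text \<open>At a node only its own summand survives, so g(r) is l times the product of r - z over
  the other nodes z. The nodes apart from r and r' lie outside the interval between them and
  contribute positive factors to g(r) g(r'); the pair itself contributes (r - r') (r' - r) <
  0.\<close>

lemma residue_poly_sign_change:
  assumes "sorted_wrt (>) (map fst (xs @ (r, l) # (r', l') # ys))" "l > 0" "l' > 0"
  shows "poly (residue_poly (xs @ (r, l) # (r', l') # ys)) r * poly (residue_poly (xs @ (r, l) # (r', l') # ys)) r' < 0"
proof -
  let ?zs = "map fst (xs @ ys)"
  have prod_list_mult: "(\<Prod>z\<leftarrow>zs. f z) * (\<Prod>z\<leftarrow>zs. g z) = (\<Prod>z\<leftarrow>zs. f z * g z)" for f g :: "real \<Rightarrow> real" and zs :: "real list"
    by (induction zs) (simp_all add: mult_ac)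
  have prod_list_pos: "(\<And>z. z \<in> set zs \<Longrightarrow> f z > 0) \<Longrightarrow> (\<Prod>z\<leftarrow>zs. f z) > (0::real)" for f and zs :: "real list"
    by (induction zs) auto
  have 1: "poly (residue_poly (xs @ (r, l) # (r', l') # ys)) r = l * ((r - r') * (\<Prod>z\<leftarrow>?zs. r - z))"
    by (simp add: residue_poly_move[of xs "(r, l)"] poly_root_prod algebra_simps)
  have eq: "residue_poly (xs @ (r, l) # (r', l') # ys) = residue_poly ((r', l') # (xs @ [(r, l)]) @ ys)"
    using residue_poly_move[of "xs @ [(r, l)]" "(r', l')" ys] by simp
  have 2: "poly (residue_poly (xs @ (r, l) # (r', l') # ys)) r' = l' * ((r' - r) * (\<Prod>z\<leftarrow>?zs. r' - z))"
    unfolding eq by (simp add: poly_root_prod algebra_simps)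
  have rr: "r > r'"
    using assms(1) by (auto simp: sorted_wrt_append)
  have "(\<Prod>z\<leftarrow>?zs. r - z) * (\<Prod>z\<leftarrow>?zs. r' - z) = (\<Prod>z\<leftarrow>?zs. (r - z) * (r' - z))"
    by (rule prod_list_mult)
  moreover have "(\<Prod>z\<leftarrow>?zs. (r - z) * (r' - z)) > 0"
  proof -
    have "(r - z) * (r' - z) > 0" if "z \<in> set ?zs" for z
      using assms(1) that rr
      by (auto simp: sorted_wrt_append zero_less_mult_iff)
    thus ?thesis
      by (rule prod_list_pos)
  qed
  ultimately have pos: "(\<Prod>z\<leftarrow>?zs. r - z) * (\<Prod>z\<leftarrow>?zs. r' - z) > 0"
    by simp
  have "l * l' * ((r - r') * (r' - r)) * ((\<Prod>z\<leftarrow>?zs. r - z) * (\<Prod>z\<leftarrow>?zs. r' - z)) < 0"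
    by (rule mult_neg_pos[OF _ pos]) (use rr assms(2,3) in \<open>simp add: mult_pos_neg\<close>)
  thus ?thesis
    unfolding 1 2 by (simp only: mult_ac)
qed

text \<open>Between adjacent nodes the sign change gives a root of g, one for each of the
  \<open>n\<close> gaps. As g has degree at most \<open>n\<close>, these are all its roots, and they
  are simple.\<close>

lemma count_interlace_distinct:
  assumes "sorted_wrt (>) (map fst xs)" "\<forall>(r, l)\<in>set xs. l > 0" "residue_poly xs \<noteq> 0"
  shows "count_interlace (proots (residue_poly xs)) (proots (root_prod (map fst xs)))"
proof -
  let ?g = "residue_poly xs" and ?rs = "map fst xs"
  define n where "n = length xs - 1"
  have n: "length xs = Suc n"
    using assms(3) by (cases xs) (auto simp: n_def)
  have "\<exists>y. ?rs ! Suc i < y \<and> y < ?rs ! i \<and> poly ?g y = 0" if i: "i < n" for i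
  proof -
    obtain r l r' l' where rl: "xs ! i = (r, l)" "xs ! Suc i = (r', l')"
      by (metis surj_pair)
    have "drop i xs = (r, l) # (r', l') # drop (Suc (Suc i)) xs"
      using i n rl by (simp add: Cons_nth_drop_Suc[symmetric])
    hence xs: "xs = take i xs @ (r, l) # (r', l') # drop (Suc (Suc i)) xs"
      by (metis append_take_drop_id)
    have mem: "(r, l) \<in> set xs" "(r', l') \<in> set xs"
      using rl i n by (metis Suc_lessD nth_mem Suc_less_eq)+
    have "poly ?g r * poly ?g r' < 0"
      using residue_poly_sign_change[of "take i xs" r l r' l' "drop (Suc (Suc i)) xs"] assms(1,2) mem
      unfolding xs[symmetric] by auto
    hence s: "poly ?g r' * poly ?g r < 0"
      by (simp add: mult.commute)
    have "r' < r"
      using sorted_wrt_nth_less[OF assms(1), of i "Suc i"] rl i n by simp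
    from poly_IVT[OF this s] show ?thesis
      using rl i n by auto
  qed
  then obtain y where y: "\<And>i. i < n \<Longrightarrow> ?rs ! Suc i < y i" "\<And>i. i < n \<Longrightarrow> y i < ?rs ! i"
      "\<And>i. i < n \<Longrightarrow> poly ?g (y i) = 0"
    by metis
  define ys where "ys = map y [0..<n]"
  have "y j < y i" if "i < j" "j < n" for i j
  proof -
    have "?rs ! j \<le> ?rs ! Suc i"
      using sorted_wrt_nth_less[OF assms(1), of "Suc i" j] that n by (cases "j = Suc i") auto
    thus ?thesis
      using y(2)[of j] y(1)[of i] that by linarith
  qed
  hence "inj_on y {..<n}"
    by (intro linorder_inj_onI) (force, linarith)
  hence dist: "distinct ys"
    by (simp add: ys_def distinct_map atLeast0LessThan)
  have "mset ys \<subseteq># proots ?g"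
  proof (rule mset_subset_eqI)
    fix a
    show "count (mset ys) a \<le> count (proots ?g) a"
    proof (cases "a \<in> set ys")
      case True
      hence "count (mset ys) a = 1"
        using dist by (simp add: distinct_count_atmost_1)
      moreover have "order a ?g > 0"
        using True y(3) assms(3) by (auto simp: ys_def order_gt_0_iff)
      ultimately show ?thesis
        using assms(3) by simp
    qed (simp add: count_eq_zero_iff[THEN iffD2])
  qed
  moreover have "size (proots ?g) \<le> size (mset ys)"
    using size_proots_le[of ?g] degree_residue_poly[of xs] assms(3) n by (simp add: ys_def)
  ultimately have g: "proots ?g = mset ys"
    by (metis mset_subset_size not_less subset_mset.le_imp_less_or_eq)
  have f: "proots (root_prod ?rs) = mset ?rs"
    by (rule proots_root_prod)
  \<comment> \<open>Position by position, the roots of g lie below the nodes without the last one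
    and above the nodes without the first one.\<close>
  have "list_all2 (\<ge>) (butlast ?rs) ys"
    using n y(2) by (auto simp: list_all2_conv_all_nth ys_def nth_butlast less_imp_le)
  hence "count_ge c (mset ys) \<le> count_ge c (mset (butlast ?rs))" for c
    by (rule count_ge_mono)
  moreover have "count_ge c (mset (butlast ?rs)) \<le> count_ge c (mset ?rs)" for c
    unfolding count_ge_def by (intro size_mset_mono multiset_filter_mono)
       (metis append_butlast_last_id butlast.simps(1) mset_append mset_subset_eq_add_left subset_mset.order_refl)
  moreover have "list_all2 (\<ge>) ys (tl ?rs)"
    using n y(1) by (auto simp: list_all2_conv_all_nth ys_def nth_tl less_imp_le)
  hence "count_ge c (mset (tl ?rs)) \<le> count_ge c (mset ys)" for c
    by (rule count_ge_mono)
  moreover have "count_ge c (mset ?rs) \<le> Suc (count_ge c (mset (tl ?rs)))" for c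
    using n by (cases ?rs) auto
  ultimately show ?thesis
    unfolding count_interlace_def f g by (meson le_trans Suc_le_mono)
qed

lemma count_interlace_linear_factor:
  assumes "count_interlace (proots g) (proots f)" "f \<noteq> 0" "g \<noteq> 0"
  shows "count_interlace (proots ([:- r, 1:] * g)) (proots ([:- r, 1:] * f))"
  using assms by (auto simp: count_interlace_def proots_mult simp del: mult_pCons_left)

lemma not_distinct_fst_decomp:
  "\<not> distinct (map fst xs) \<Longrightarrow> \<exists>as r l bs l' cs. xs = as @ (r, l) # bs @ (r, l') # cs"
proof (induction xs)
  case (Cons x xs)
  obtain r l where x: "x = (r, l)"
    by (cases x)
  show ?case
  proof (cases "r \<in> fst ` set xs")
    case True
    then obtain l' where "(r, l') \<in> set xs"
      by auto
    then obtain bs cs where "xs = bs @ (r, l') # cs"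
      by (metis split_list)
    hence "x # xs = [] @ (r, l) # bs @ (r, l') # cs"
      using x by simp
    thus ?thesis
      by blast
  next
    case False
    then obtain as r' k bs k' cs where "xs = as @ (r', k) # bs @ (r', k') # cs"
      using Cons x by auto
    hence "x # xs = (x # as) @ (r', k) # bs @ (r', k') # cs"
      by simp
    thus ?thesis
      by blast
  qed
qed simp

text \<open>Induction on the number of nodes, down to distinct nodes with positive residues. A node
  with residue 0, or two equal nodes merged into one with residue \<open>l + l'\<close>, exhibits x
  - r as a common factor of both polynomials, and common factors preserve
  \<open>count_interlace\<close>.\<close>

lemma count_interlace_residue_poly:
  assumes "\<forall>(r, l)\<in>set xs. l \<ge> 0" "residue_poly xs \<noteq> 0"
  shows "count_interlace (proots (residue_poly xs)) (proots (root_prod (map fst xs)))"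
  using assms
proof (induction xs rule: length_induct)
  case (1 xs)
  have reduce: ?case
    if f: "root_prod (map fst xs) = [:- r, 1:] * root_prod (map fst xs')"
      and g: "residue_poly xs = [:- r, 1:] * residue_poly xs'"
      and xs': "length xs' < length xs" "\<forall>(r, l)\<in>set xs'. l \<ge> 0" for r xs'
  proof -
    have "residue_poly xs' \<noteq> 0"
      using g "1.prems"(2) by auto
    thus ?thesis
      unfolding f g using "1.IH" xs' by (intro count_interlace_linear_factor) auto
  qed
  have "\<forall>(r, l)\<in>set xs. l > 0" if "\<forall>r. (r, 0) \<notin> set xs"
    using "1.prems"(1) that by (auto simp: less_le)
  then consider r where "(r, 0) \<in> set xs" | "\<not> distinct (map fst xs)"
    | "distinct (map fst xs)" "\<forall>(r, l)\<in>set xs. l > 0"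
    by blast
  thus ?case
  proof cases
    case (1 r)
    then obtain as bs where xs: "xs = as @ (r, 0) # bs"
      by (metis split_list)
    show ?thesis
    proof (rule reduce[of r "as @ bs"])
      show "residue_poly xs = [:- r, 1:] * residue_poly (as @ bs)"
        unfolding xs residue_poly_move by simp
    qed (use xs "1.prems" in \<open>auto simp: mult_ac simp del: mult_pCons_left mult_pCons_right\<close>)
  next
    case 2
    then obtain r l l' as bs cs where xs: "xs = as @ (r, l) # bs @ (r, l') # cs"
      using not_distinct_fst_decomp by blast
    let ?ys = "as @ bs @ cs"
    have m: "residue_poly xs = residue_poly ((r, l) # (r, l') # ?ys)"
      unfolding xs by (rule residue_poly_mset_cong) simp
    show ?thesis
    proof (rule reduce[of r "(r, l + l') # ?ys"])
      show "residue_poly xs = [:- r, 1:] * residue_poly ((r, l + l') # ?ys)"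
        unfolding m residue_poly.simps
        by (simp add: smult_add_left algebra_simps del: mult_pCons_left mult_pCons_right)
    qed (use xs "1.prems" in \<open>auto simp: mult_ac simp del: mult_pCons_left mult_pCons_right\<close>)
  next
    case 3
    define ys where "ys = rev (sort_key fst xs)"
    have ys: "mset ys = mset xs" "set ys = set xs"
      by (simp_all add: ys_def)
    have mf: "mset (map fst ys) = mset (map fst xs)"
      by (simp only: mset_map ys)
    have "sorted_wrt (\<ge>) (map fst ys)"
      by (simp add: ys_def rev_map[symmetric] sorted_wrt_rev)
    moreover have "distinct (map fst ys)"
      using 3(1) mf by (metis mset_eq_imp_distinct_iff)
    ultimately have "sorted_wrt (>) (map fst ys)"
      by (simp add: sorted_wrt_iff_nth_less distinct_conv_nth less_le)
    thus ?thesis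
      using count_interlace_distinct[of ys] 3(2) "1.prems"(2)
      unfolding residue_poly_mset_cong[OF ys(1)] root_prod_mset_cong[OF mf] ys(2) by simp
  qed
qed

section \<open>Interlacing of the h-star polynomials\<close>

lemma poly_eqI_pos:
  fixes p q :: "real poly"
  assumes "\<And>t. t > 0 \<Longrightarrow> poly p t = poly q t"
  shows "p = q"
proof (rule ccontr)
  assume "p \<noteq> q"
  hence "finite {t. poly (p - q) t = 0}"
    by (intro poly_roots_finite) simp
  moreover have "{0<..} \<subseteq> {t. poly (p - q) t = 0}"
    using assms by auto
  ultimately show False
    using infinite_Ioi finite_subset by blast
qed

text \<open>Positive t keeps 1 + t invertible, and by \<open>poly_eqI_pos\<close> the values there
  determine a polynomial.\<close>

lemma poly_bip_h:
  assumes "t > 0"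
  shows "poly (bip_h a b) t = (1 + t) ^ (a + b + 1) * poly (gamma_poly a b) (t / (1 + t) ^ 2)"
proof -
  have "(1 + t) ^ (a + b + 1 - 2 * i) * t ^ i = (1 + t) ^ (a + b + 1) * (t / (1 + t) ^ 2) ^ i" if "i \<le> min a b" for i
  proof -
    have "(1 + t) ^ (a + b + 1) = (1 + t) ^ (a + b + 1 - 2 * i) * ((1 + t) ^ 2) ^ i"
      unfolding power_mult[symmetric] power_add[symmetric] using that by (intro arg_cong[of _ _ "power _"]) auto
    thus ?thesis
      using assms by (simp add: power_divide)
  qed
  thus ?thesis
    unfolding bip_h_def gamma_poly_def poly_sum sum_distrib_left
    by (intro sum.cong refl) (simp add: poly_monom poly_power mult_ac del: of_nat_mult)
qed

text \<open>The operator x d/dx multiplies the i-th coefficient by i, and (b + 1) C(b, i) = (b + 1 -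
  i) C(b + 1, i).\<close>

lemma gamma_poly_Suc_pderiv:
  "smult (real (Suc b)) (gamma_poly a b) = smult (real (Suc b)) (gamma_poly a (Suc b)) - [:0, 1:] * pderiv (gamma_poly a (Suc b))"
proof (rule poly_eqI)
  fix i
  have "Suc b * (b choose i) = (Suc b - i) * (Suc b choose i)"
    using binomial_absorb_comp[of "Suc b" i] by simp
  hence "real (Suc b) * real (b choose i) = (real (Suc b) - real i) * real (Suc b choose i)"
    by (cases "i \<le> Suc b") (metis of_nat_diff of_nat_mult, simp add: binomial_eq_0)
  hence "real (Suc b) * coeff (gamma_poly a b) i = (real (Suc b) - real i) * coeff (gamma_poly a (Suc b)) i"
    by (simp add: coeff_gamma_poly del: of_nat_Suc binomial_Suc_Suc)
  thus "coeff (smult (real (Suc b)) (gamma_poly a b)) i =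
    coeff (smult (real (Suc b)) (gamma_poly a (Suc b)) - [:0, 1:] * pderiv (gamma_poly a (Suc b))) i"
    by (cases i) (simp_all add: coeff_pderiv left_diff_distrib del: of_nat_Suc)
qed

text \<open>Logarithmic derivative, with s x / (1 + s x) = 1 - 1 / (1 + s x) for each
  factor.\<close>

lemma poly_linear_prod_pderiv:
  fixes ss :: "real list"
  assumes "x > 0" "\<forall>s\<in>set ss. s > 0"
  shows "x * poly (pderiv (\<Prod>s\<leftarrow>ss. [:1, s:])) x =
    poly (\<Prod>s\<leftarrow>ss. [:1, s:]) x * (real (length ss) - (\<Sum>s\<leftarrow>ss. 1 / (1 + s * x)))"
  using assms(2)
proof (induction ss)
  case (Cons s ss)
  let ?P = "poly (\<Prod>s\<leftarrow>ss. [:1, s:]) x" and ?S = "\<Sum>s\<leftarrow>ss. 1 / (1 + s * x)"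
  have "1 + s * x \<noteq> 0"
    using Cons.prems assms(1) by (smt (verit) list.set_intros(1) mult_pos_pos)
  hence alg: "(1 + s * x) * (P * (L - S)) + x * s * P = ((1 + s * x) * P) * (1 + L - (1 / (1 + s * x) + S))" for P L S
    by (simp add: field_simps)
  have "x * poly (pderiv (\<Prod>s\<leftarrow>s # ss. [:1, s:])) x = (1 + s * x) * (x * poly (pderiv (\<Prod>s\<leftarrow>ss. [:1, s:])) x) + x * s * ?P"
    by (simp add: pderiv_mult pderiv_pCons algebra_simps del: mult_pCons_left)
  also have "\<dots> = (1 + s * x) * (?P * (real (length ss) - ?S)) + x * s * ?P"
    using Cons by simp
  finally have d: "x * poly (pderiv (\<Prod>s\<leftarrow>s # ss. [:1, s:])) x =
      ((1 + s * x) * ?P) * (1 + real (length ss) - (1 / (1 + s * x) + ?S))"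
    unfolding alg .
  have p: "poly (\<Prod>s\<leftarrow>s # ss. [:1, s:]) x = (1 + s * x) * ?P"
    by (simp add: algebra_simps)
  show ?case
    unfolding d p by simp
qed simp

lemma quadratic_roots:
  fixes s :: real
  assumes "s > 0"
  obtains r where "r < 0" "r + 1 / r = - (2 + s)"
proof -
  define q where "q = sqrt ((2 + s) ^ 2 - 4)"
  define r where "r = - ((2 + s) + q) / 2"
  have "(2 + s) ^ 2 - 4 \<ge> 0"
    using assms by (simp add: power2_eq_square algebra_simps)
  hence sq: "q ^ 2 = (2 + s) ^ 2 - 4" "q \<ge> 0"
    by (auto simp: q_def)
  have r: "r < 0"
    unfolding r_def using assms sq(2) by (simp add: field_simps)
  have "r * r + 1 = - (2 + s) * r"
    using sq(1) unfolding r_def by (simp add: power2_eq_square field_simps)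
  hence "r + 1 / r = - (2 + s)"
    using r by (simp add: field_simps)
  with r show thesis
    by (rule that)
qed

text \<open>The roots of \<open>(1 + t)\<^sup>2 + s t\<close> are \<open>r\<close> and \<open>1 / r\<close> with \<open>r < 0\<close>, and
  \<open>(1 + t) / ((t - r) (t - 1 / r))\<close> has the nonnegative residues \<open>- r / (1 - r)\<close> and \<open>1 / (1 - r)\<close>.\<close>

lemma quadratic_nodes:
  assumes "\<forall>s\<in>set ss. s > (0::real)"
  shows "\<exists>xs. (\<forall>(r, l)\<in>set xs. r < 0 \<and> l \<ge> 0) \<and>
    (\<forall>t>0. poly (root_prod (map fst xs)) t = (\<Prod>s\<leftarrow>ss. (1 + t) ^ 2 + s * t)) \<and>
    (\<forall>t>0. (\<Sum>(r, l)\<leftarrow>xs. l / (t - r)) = (\<Sum>s\<leftarrow>ss. (1 + t) / ((1 + t) ^ 2 + s * t)))"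
  using assms
proof (induction ss)
  case Nil
  show ?case
    by (intro exI[of _ "[]"]) simp
next
  case (Cons s ss)
  then obtain xs where xs: "\<forall>(r, l)\<in>set xs. r < 0 \<and> l \<ge> 0"
    "\<forall>t>0. poly (root_prod (map fst xs)) t = (\<Prod>s\<leftarrow>ss. (1 + t) ^ 2 + s * t)"
    "\<forall>t>0. (\<Sum>(r, l)\<leftarrow>xs. l / (t - r)) = (\<Sum>s\<leftarrow>ss. (1 + t) / ((1 + t) ^ 2 + s * t))"
    by auto
  obtain r where r: "r < 0" "r + 1 / r = - (2 + s)"
    using quadratic_roots[of s] Cons.prems by auto
  let ?ys = "(r, - r / (1 - r)) # (1 / r, 1 / (1 - r)) # xs"
  have q: "(t - r) * (t - 1 / r) = (1 + t) ^ 2 + s * t" for t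
  proof -
    have "(t - r) * (t - 1 / r) = t ^ 2 - (r + 1 / r) * t + 1"
      using r(1) by (simp add: field_simps power2_eq_square)
    thus ?thesis
      unfolding r(2) by (simp add: power2_eq_square algebra_simps)
  qed
  have res: "- r / (1 - r) / (t - r) + 1 / (1 - r) / (t - 1 / r) = (1 + t) / ((1 + t) ^ 2 + s * t)" if "t > 0" for t
  proof -
    have nz: "t - r \<noteq> 0" "t - 1 / r \<noteq> 0" "1 - r \<noteq> 0" "r \<noteq> 0"
      using r(1) that by (auto simp: divide_less_0_iff)
    have "- r / (1 - r) / (t - r) + 1 / (1 - r) / (t - 1 / r) =
      (- r * (t - 1 / r) + (t - r)) / ((1 - r) * ((t - r) * (t - 1 / r)))"
      using nz(1-3) by (simp add: divide_simps)
    also have "- r * (t - 1 / r) + (t - r) = (1 - r) * (1 + t)"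
      using nz(4) by (simp add: algebra_simps)
    finally show ?thesis
      using nz(3) by (simp add: q)
  qed
  have "(\<forall>(r, l)\<in>set ?ys. r < 0 \<and> l \<ge> 0)"
    using xs(1) r(1) by (auto simp: divide_simps)
  moreover have "\<forall>t>0. poly (root_prod (map fst ?ys)) t = (\<Prod>s\<leftarrow>s # ss. (1 + t) ^ 2 + s * t)"
  proof (intro allI impI)
    fix t :: real assume t: "t > 0"
    have "poly (root_prod (map fst ?ys)) t = ((t - r) * (t - 1 / r)) * poly (root_prod (map fst xs)) t"
      by (simp only: poly_root_prod list.map fst_conv prod_list.Cons mult.assoc)
    thus "poly (root_prod (map fst ?ys)) t = (\<Prod>s\<leftarrow>s # ss. (1 + t) ^ 2 + s * t)"
      unfolding q using xs(2) t by simp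
  qed
  moreover have "\<forall>t>0. (\<Sum>(r, l)\<leftarrow>?ys. l / (t - r)) = (\<Sum>s\<leftarrow>s # ss. (1 + t) / ((1 + t) ^ 2 + s * t))"
    using xs(3) res by (simp add: add.assoc[symmetric])
  ultimately show ?case
    by blast
qed

text \<open>Write \<gamma> as a product of m factors 1 + s x and put x = t / (1 + t)^2. Then h-star
  is (1 + t)^(a + b + 1 - 2m) times the product of (1 + t)^2 + s t. By
  \<open>gamma_poly_Suc_pderiv\<close>, b times the quotient of h-star for b - 1 by that for b is (b
  - m) / (1 + t) + \<Sum> (1 + t) / ((1 + t)^2 + s t).\<close>

lemma bip_h_nodes:
  obtains xs where "\<forall>(r, l)\<in>set xs. l \<ge> 0" "bip_h a b = root_prod (map fst xs)"
    "b > 0 \<Longrightarrow> smult (real b) (bip_h a (b - 1)) = residue_poly xs"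
proof -
  obtain ss where ss: "\<forall>s\<in>set ss. s > 0" "gamma_poly a b = (\<Prod>s\<leftarrow>ss. [:1, s:])"
    using pos_prod_gamma_poly[of a b] by (auto simp: pos_prod_def)
  obtain ys where ys: "\<forall>(r, l)\<in>set ys. r < 0 \<and> l \<ge> 0"
    "\<And>t. t > 0 \<Longrightarrow> poly (root_prod (map fst ys)) t = (\<Prod>s\<leftarrow>ss. (1 + t) ^ 2 + s * t)"
    "\<And>t. t > 0 \<Longrightarrow> (\<Sum>(r, l)\<leftarrow>ys. l / (t - r)) = (\<Sum>s\<leftarrow>ss. (1 + t) / ((1 + t) ^ 2 + s * t))"
    using quadratic_nodes[OF ss(1)] by blast
  have "degree (\<Prod>s\<leftarrow>ss. [:1, s:]) = length ss"
  proof -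
    have "(\<Prod>s\<leftarrow>ss. [:1, s:]) \<noteq> 0" for ss :: "real list"
      by (induction ss) (auto simp del: mult_pCons_left)
    thus ?thesis
      using ss(1) by (induction ss) (auto simp: degree_mult_eq simp del: mult_pCons_left)
  qed
  moreover have "degree (gamma_poly a b) \<le> min a b"
    by (rule degree_le) (auto simp: coeff_gamma_poly binomial_eq_0)
  ultimately have len: "length ss \<le> a" "length ss \<le> b"
    using ss(2) by auto
  define d where "d = a + b - 2 * length ss"
  \<comment> \<open>The node -1 has d + 1 copies here; one carries the residue b - m, the others 0.
    This residue is nonnegative because \<gamma> has degree m \<le> b.\<close>
  let ?xs = "(- 1, real b - real (length ss)) # replicate d (- 1, 0) @ ys"
  have pos: "\<forall>(r, l)\<in>set ?xs. r < 0 \<and> l \<ge> 0"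
    using ys(1) len by auto
  have h: "poly (bip_h a b) t = poly (root_prod (map fst ?xs)) t" if t: "t > 0" for t
  proof -
    have prod: "(\<Prod>s\<leftarrow>ss. (1 + t) ^ 2 + s * t) = ((1 + t) ^ 2) ^ length ss * poly (\<Prod>s\<leftarrow>ss. [:1, s:]) (t / (1 + t) ^ 2)"
      using t by (induction ss) (simp_all add: field_simps)
    have "a + b + 1 = Suc d + 2 * length ss"
      using len by (simp add: d_def)
    hence E: "(1 + t) ^ (a + b + 1) = (1 + t) ^ Suc d * ((1 + t) ^ 2) ^ length ss"
      by (simp only: power_add power_mult)
    have "poly (bip_h a b) t = (1 + t) ^ Suc d * (\<Prod>s\<leftarrow>ss. (1 + t) ^ 2 + s * t)"
      unfolding prod poly_bip_h[OF t] ss(2) E by (simp only: mult.assoc)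
    also have "\<dots> = poly (root_prod (map fst ?xs)) t"
      using ys(2)[OF t] by (simp add: poly_root_prod map_replicate_const algebra_simps)
    finally show ?thesis .
  qed
  have "smult (real b) (bip_h a (b - 1)) = residue_poly ?xs" if b: "b > 0"
  proof (rule poly_eqI_pos)
    fix t :: real assume t: "t > 0"
    define x where "x = t / (1 + t) ^ 2"
    have x: "x > 0"
      using t by (simp add: x_def)
    obtain b' where b': "b = Suc b'"
      using b by (cases b) auto
    have sum: "1 / (1 + s * x) = (1 + t) * ((1 + t) / ((1 + t) ^ 2 + s * t))" for s
    proof -
      have "1 / (1 + s * (t / u)) = u / (u + s * t)" if "u > 0" for u
      proof -
        have "1 + s * (t / u) = (u + s * t) / u"
          using that by (simp add: add_divide_distrib)
        thus ?thesis
          by simp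
      qed
      thus ?thesis
        using t by (simp add: x_def power2_eq_square)
    qed
    have "real b * poly (gamma_poly a b') x = real b * poly (gamma_poly a b) x - x * poly (pderiv (gamma_poly a b)) x"
      using arg_cong[OF gamma_poly_Suc_pderiv[of b' a], of "\<lambda>p. poly p x"] by (simp add: b' del: of_nat_Suc)
    also have "\<dots> = poly (gamma_poly a b) x * (real b - real (length ss) + (\<Sum>s\<leftarrow>ss. 1 / (1 + s * x)))"
      unfolding ss(2) poly_linear_prod_pderiv[OF x ss(1)] by (simp add: algebra_simps)
    also have "(\<Sum>s\<leftarrow>ss. 1 / (1 + s * x)) = (1 + t) * (\<Sum>(r, l)\<leftarrow>ys. l / (t - r))"
      unfolding ys(3)[OF t] sum sum_list_const_mult ..
    finally have g: "real b * poly (gamma_poly a b') x =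
      poly (gamma_poly a b) x * (real b - real (length ss) + (1 + t) * (\<Sum>(r, l)\<leftarrow>ys. l / (t - r)))" .
    have "poly (smult (real b) (bip_h a (b - 1))) t = (1 + t) ^ (a + b) * (real b * poly (gamma_poly a b') x)"
      using poly_bip_h[OF t, of a b'] by (simp add: b' x_def)
    also have "\<dots> = (1 + t) ^ (a + b + 1) * poly (gamma_poly a b) x *
        ((real b - real (length ss)) / (1 + t) + (\<Sum>(r, l)\<leftarrow>ys. l / (t - r)))"
    proof -
      have alg: "c * (p * (k + (1 + t) * S)) = (c * (1 + t)) * p * (k / (1 + t) + S)" for c p k S
        using t by (simp add: field_simps)
      have pow: "(1 + t) ^ (a + b + 1) = (1 + t) ^ (a + b) * (1 + t)"
        by simp
      show ?thesis
        unfolding g pow by (rule alg)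
    qed
    also have "(1 + t) ^ (a + b + 1) * poly (gamma_poly a b) x = poly (root_prod (map fst ?xs)) t"
      unfolding h[OF t, symmetric] poly_bip_h[OF t] x_def ..
    also have "(real b - real (length ss)) / (1 + t) + (\<Sum>(r, l)\<leftarrow>ys. l / (t - r)) = (\<Sum>(r, l)\<leftarrow>?xs. l / (t - r))"
      by (simp add: sum_list_replicate add.commute)
    also have "poly (root_prod (map fst ?xs)) t * (\<Sum>(r, l)\<leftarrow>?xs. l / (t - r)) = poly (residue_poly ?xs) t"
      by (rule poly_residue_poly_quotient[symmetric]) (use pos t in fastforce)
    finally show "poly (smult (real b) (bip_h a (b - 1))) t = poly (residue_poly ?xs) t" .
  qed
  moreover have "bip_h a b = root_prod (map fst ?xs)"
    using h by (rule poly_eqI_pos)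
  ultimately show thesis
    using pos by (intro that[of ?xs]) auto
qed

lemma real_rooted_bip_h: "real_rooted (bip_h a b)"
  using bip_h_nodes[of a b] real_rooted_root_prod[of 1] by (metis smult_1_left zero_neq_one)

lemma interlaces_bip_h:
  assumes "b > 0"
  shows "interlaces (bip_h a (b - 1)) (bip_h a b)"
proof -
  obtain xs where xs: "\<forall>(r, l)\<in>set xs. l \<ge> 0" "bip_h a b = root_prod (map fst xs)"
    "smult (real b) (bip_h a (b - 1)) = residue_poly xs"
    using bip_h_nodes[of a b] assms by metis
  have "residue_poly xs \<noteq> 0"
    using xs(3) real_rooted_nonzero[OF real_rooted_bip_h] assms by (metis of_nat_0_eq_iff smult_eq_0_iff less_irrefl)
  hence "count_interlace (proots (bip_h a (b - 1))) (proots (bip_h a b))"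
    using count_interlace_residue_poly[OF xs(1)] assms
    unfolding xs(2) xs(3)[symmetric] by simp
  thus ?thesis
    by (intro interlaces_count real_rooted_bip_h)
qed

theorem theorem4p8:
  shows "(\<forall>a b :: nat. real_rooted (h_star_bipartite a b)) \<and>
         (\<forall>a b :: nat. b \<ge> 1 \<longrightarrow>
            interlaces (h_star_bipartite a (b - 1)) (h_star_bipartite a b))"
  unfolding h_star_bipartite_eq by (intro conjI allI impI real_rooted_bip_h interlaces_bip_h) simp

end
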